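(* Let $p\in(0,\infty)$, let $\mathfrak N_1$ and $\mathfrak N_2$ be two finite factors, and let $\psi:\mathscr U(\mathfrak N_1)\to\mathscr U(\mathfrak N_2)$ be a surjective $L^p$-isometry such that $\psi(I)=I$. Then for every $U\in\mathscr U(\mathfrak N_1)$, $U^*=U$ if and only if $\psi(U)^*=\psi(U)$.
   Context: A finite factor is a von Neumann algebra factor admitting a (unique, faithful, normal) tracial state, i.e. $M_n(\mathbb C)$ or a $\mathrm{II}_1$ factor. For a finite factor $\mathfrak N$ with tracial state $\tau$, $\mathscr U(\mathfrak N)$ is its unitary group and $\|A\|_p:=\tau(|A|^p)^{1/p}$. A map $\psi:\mathscr U(\mathfrak N_1)\to\mathscr U(\mathfrak N_2)$ is an $L^p$-isometry if $\|U-V\|_p=\|\psi(U)-\psi(V)\|_p$ for all $U,V\in\mathscr U(\mathfrak N_1)$, each side computed with the tracial state of the respective factor. *)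

theory Defs
  imports "HOL-Analysis.Analysis" "HOL-Computational_Algebra.Polynomial"
begin

section \<open>Complex Hilbert spaces\<close>

text \<open>
  The underlying real Hilbert space, and hence the norm, metric and topology, is provided by
  \<^class>\<open>real_inner\<close>; the last axiom makes the norm of a vector \<open>x\<close> equal to the square root of
  \<open>cinner x x\<close>. The inner product is linear in its second argument.
\<close>

class complex_hilbert_space = real_inner + complete_space +
  fixes scaleC :: "complex \<Rightarrow> 'a \<Rightarrow> 'a"  (infixr "*\<^sub>C" 75)
    and cinner :: "'a \<Rightarrow> 'a \<Rightarrow> complex"
  assumes scaleC_add_right: "c *\<^sub>C (x + y) = c *\<^sub>C x + c *\<^sub>C y"
    and scaleC_add_left: "(c + d) *\<^sub>C x = c *\<^sub>C x + d *\<^sub>C x"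
    and scaleC_scaleC: "c *\<^sub>C d *\<^sub>C x = (c * d) *\<^sub>C x"
    and scaleR_scaleC: "r *\<^sub>R x = complex_of_real r *\<^sub>C x"
    and cinner_commute: "cinner x y = cnj (cinner y x)"
    and cinner_add_right: "cinner x (y + z) = cinner x y + cinner x z"
    and cinner_scaleC_right: "cinner x (c *\<^sub>C y) = c * cinner x y"
    and inner_eq_Re_cinner: "inner x y = Re (cinner x y)"

lemma norm_scaleC: "norm (c *\<^sub>C x) = cmod c * norm (x::'a::complex_hilbert_space)"
proof -
  have "cinner (c *\<^sub>C x) (c *\<^sub>C x) = c * cnj c * cinner x x"
    by (subst cinner_scaleC_right, subst cinner_commute, subst cinner_scaleC_right,
        subst (2) cinner_commute) simp
  also have "\<dots> = complex_of_real ((cmod c)\<^sup>2) * cinner x x"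
    by (simp only: complex_norm_square)
  finally have "inner (c *\<^sub>C x) (c *\<^sub>C x) = (cmod c)\<^sup>2 * inner x x"
    by (simp add: inner_eq_Re_cinner)
  then show ?thesis
    by (simp add: norm_eq_sqrt_inner real_sqrt_mult)
qed

lemma bounded_linear_scaleC: "bounded_linear ((*\<^sub>C) c :: 'a::complex_hilbert_space \<Rightarrow> 'a)"
proof (rule bounded_linear_intro[where K = "cmod c"])
  show "c *\<^sub>C r *\<^sub>R x = r *\<^sub>R c *\<^sub>C x" for r and x :: 'a
    by (simp add: scaleR_scaleC scaleC_scaleC mult.commute)
qed (simp_all add: scaleC_add_right norm_scaleC mult.commute)


section \<open>Bounded operators\<close>

text \<open>
  The type \<open>'h \<Rightarrow>\<^sub>L 'h\<close> consists of the bounded real-linear operators, with the operator norm;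
  \<open>bounded_ops\<close> is the algebra \<open>B(H)\<close> of bounded complex-linear ones.
\<close>

definition bounded_ops :: "('h::complex_hilbert_space \<Rightarrow>\<^sub>L 'h) set" where
  "bounded_ops = {T. \<forall>c x. blinfun_apply T (c *\<^sub>C x) = c *\<^sub>C blinfun_apply T x}"

definition scalar_op :: "complex \<Rightarrow> 'h::complex_hilbert_space \<Rightarrow>\<^sub>L 'h" where
  "scalar_op c = Blinfun ((*\<^sub>C) c)"

lemma scalar_op_apply [simp]: "blinfun_apply (scalar_op c) x = c *\<^sub>C x"
  by (simp add: scalar_op_def bounded_linear_Blinfun_apply bounded_linear_scaleC)

definition adj :: "('h::complex_hilbert_space \<Rightarrow>\<^sub>L 'h) \<Rightarrow> 'h \<Rightarrow>\<^sub>L 'h" where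
  "adj T = (THE S. \<forall>x y. cinner (blinfun_apply S x) y = cinner x (blinfun_apply T y))"

definition positive_op :: "('h::complex_hilbert_space \<Rightarrow>\<^sub>L 'h) \<Rightarrow> bool" where
  "positive_op T \<longleftrightarrow> T \<in> bounded_ops \<and> (\<forall>x. cinner x (blinfun_apply T x) \<in> \<real>\<^sub>\<ge>\<^sub>0)"

definition op_le :: "('h::complex_hilbert_space \<Rightarrow>\<^sub>L 'h) \<Rightarrow> ('h \<Rightarrow>\<^sub>L 'h) \<Rightarrow> bool" where
  "op_le S T \<longleftrightarrow> positive_op (T - S)"

definition op_spectrum :: "('h::complex_hilbert_space \<Rightarrow>\<^sub>L 'h) \<Rightarrow> complex set" where
  "op_spectrum T = {z. \<not> (\<exists>S \<in> bounded_ops.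
     S o\<^sub>L (T - scalar_op z) = id_blinfun \<and> (T - scalar_op z) o\<^sub>L S = id_blinfun)}"

definition op_power :: "('h::complex_hilbert_space \<Rightarrow>\<^sub>L 'h) \<Rightarrow> nat \<Rightarrow> 'h \<Rightarrow>\<^sub>L 'h" where
  "op_power T n = ((o\<^sub>L) T ^^ n) id_blinfun"

definition op_poly :: "real poly \<Rightarrow> ('h::complex_hilbert_space \<Rightarrow>\<^sub>L 'h) \<Rightarrow> 'h \<Rightarrow>\<^sub>L 'h" where
  "op_poly q T = (\<Sum>i\<le>degree q. coeff q i *\<^sub>R op_power T i)"

text \<open>
  Continuous functional calculus for a self-adjoint operator \<open>T\<close> and a real function \<open>f\<close>
  continuous on the spectrum of \<open>T\<close> (which is real): \<open>f(T)\<close> is the common norm limit of \<open>q\<^sub>n(T)\<close>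
  for all sequences of real polynomials \<open>q\<^sub>n\<close> converging to \<open>f\<close> uniformly on the spectrum.
  Meaningless for other \<open>T\<close> or \<open>f\<close>.
\<close>

definition cfc :: "(real \<Rightarrow> real) \<Rightarrow> ('h::complex_hilbert_space \<Rightarrow>\<^sub>L 'h) \<Rightarrow> 'h \<Rightarrow>\<^sub>L 'h" where
  "cfc f T = (THE S. \<forall>q.
     uniform_limit {t. complex_of_real t \<in> op_spectrum T} (\<lambda>n. poly (q n)) f sequentially
     \<longrightarrow> (\<lambda>n. op_poly (q n) T) \<longlonglongrightarrow> S)"

definition abs_op :: "('h::complex_hilbert_space \<Rightarrow>\<^sub>L 'h) \<Rightarrow> 'h \<Rightarrow>\<^sub>L 'h" where
  "abs_op A = cfc sqrt (adj A o\<^sub>L A)"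


section \<open>Finite factors\<close>

definition commutant ::
  "('h::complex_hilbert_space \<Rightarrow>\<^sub>L 'h) set \<Rightarrow> ('h \<Rightarrow>\<^sub>L 'h) set" where
  "commutant M = {T \<in> bounded_ops. \<forall>A\<in>M. T o\<^sub>L A = A o\<^sub>L T}"

definition von_neumann_algebra :: "('h::complex_hilbert_space \<Rightarrow>\<^sub>L 'h) set \<Rightarrow> bool" where
  "von_neumann_algebra M \<longleftrightarrow>
     M \<subseteq> bounded_ops \<and> (\<forall>A\<in>M. adj A \<in> M) \<and> commutant (commutant M) = M"

definition factor :: "('h::complex_hilbert_space \<Rightarrow>\<^sub>L 'h) set \<Rightarrow> bool" where
  "factor M \<longleftrightarrow> von_neumann_algebra M \<and> M \<inter> commutant M = range scalar_op"

text \<open>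
  Normality of a positive functional: it preserves suprema of upward directed families of
  positive elements that have a supremum in \<open>M\<close>.
\<close>

definition normal_functional ::
  "('h::complex_hilbert_space \<Rightarrow>\<^sub>L 'h) set \<Rightarrow> (('h \<Rightarrow>\<^sub>L 'h) \<Rightarrow> complex) \<Rightarrow> bool" where
  "normal_functional M \<tau> \<longleftrightarrow>
     (\<forall>D S. D \<noteq> {} \<and> D \<subseteq> {A\<in>M. positive_op A} \<and>
        (\<forall>A\<in>D. \<forall>B\<in>D. \<exists>C\<in>D. op_le A C \<and> op_le B C) \<and>
        S \<in> M \<and> (\<forall>A\<in>D. op_le A S) \<and> (\<forall>T\<in>M. (\<forall>A\<in>D. op_le A T) \<longrightarrow> op_le S T)
      \<longrightarrow> Re (\<tau> S) = (SUP A\<in>D. Re (\<tau> A)))"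

text \<open>
  Only the values of \<open>\<tau>\<close> on \<open>M\<close> matter. On a factor a tracial state is unique if it exists, and
  it is then automatically faithful and normal.
\<close>

definition tracial_state ::
  "('h::complex_hilbert_space \<Rightarrow>\<^sub>L 'h) set \<Rightarrow> (('h \<Rightarrow>\<^sub>L 'h) \<Rightarrow> complex) \<Rightarrow> bool" where
  "tracial_state M \<tau> \<longleftrightarrow>
     (\<forall>A\<in>M. \<forall>B\<in>M. \<tau> (A + B) = \<tau> A + \<tau> B) \<and>
     (\<forall>c. \<forall>A\<in>M. \<tau> (scalar_op c o\<^sub>L A) = c * \<tau> A) \<and>
     (\<forall>A\<in>M. positive_op A \<longrightarrow> \<tau> A \<in> \<real>\<^sub>\<ge>\<^sub>0) \<and>
     \<tau> id_blinfun = 1 \<and>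
     (\<forall>A\<in>M. \<forall>B\<in>M. \<tau> (A o\<^sub>L B) = \<tau> (B o\<^sub>L A))"

definition faithful_functional ::
  "('h::complex_hilbert_space \<Rightarrow>\<^sub>L 'h) set \<Rightarrow> (('h \<Rightarrow>\<^sub>L 'h) \<Rightarrow> complex) \<Rightarrow> bool" where
  "faithful_functional M \<tau> \<longleftrightarrow> (\<forall>A\<in>M. positive_op A \<and> \<tau> A = 0 \<longrightarrow> A = 0)"

definition finite_factor ::
  "('h::complex_hilbert_space \<Rightarrow>\<^sub>L 'h) set \<Rightarrow> (('h \<Rightarrow>\<^sub>L 'h) \<Rightarrow> complex) \<Rightarrow> bool" where
  "finite_factor M \<tau> \<longleftrightarrow>
     factor M \<and> tracial_state M \<tau> \<and> faithful_functional M \<tau> \<and> normal_functional M \<tau>"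

definition unitary_group ::
  "('h::complex_hilbert_space \<Rightarrow>\<^sub>L 'h) set \<Rightarrow> ('h \<Rightarrow>\<^sub>L 'h) set" where
  "unitary_group M = {U\<in>M. adj U o\<^sub>L U = id_blinfun \<and> U o\<^sub>L adj U = id_blinfun}"

definition lp_norm ::
  "(('h::complex_hilbert_space \<Rightarrow>\<^sub>L 'h) \<Rightarrow> complex) \<Rightarrow> real \<Rightarrow> ('h \<Rightarrow>\<^sub>L 'h) \<Rightarrow> real" where
  "lp_norm \<tau> p A = Re (\<tau> (cfc (\<lambda>t. t powr p) (abs_op A))) powr (1 / p)"

definition lp_isometry ::
  "real \<Rightarrow> ('h::complex_hilbert_space \<Rightarrow>\<^sub>L 'h) set \<Rightarrow> (('h \<Rightarrow>\<^sub>L 'h) \<Rightarrow> complex) \<Rightarrow>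
   (('k::complex_hilbert_space \<Rightarrow>\<^sub>L 'k) \<Rightarrow> complex) \<Rightarrow> (('h \<Rightarrow>\<^sub>L 'h) \<Rightarrow> ('k \<Rightarrow>\<^sub>L 'k)) \<Rightarrow> bool" where
  "lp_isometry p M \<tau> \<sigma> \<psi> \<longleftrightarrow>
     (\<forall>U\<in>unitary_group M. \<forall>V\<in>unitary_group M. lp_norm \<tau> p (U - V) = lp_norm \<sigma> p (\<psi> U - \<psi> V))"

end

theory Submission
  imports Defs "HOL-Computational_Algebra.Fundamental_Theorem_Algebra"
begin

text \<open>
  Self-adjointness of a unitary \<open>U\<close> is expressed through \<open>L\<^sup>p\<close>-distances between unitaries.
  For \<open>p \<noteq> 2\<close> put \<open>T = |U - I|\<^sup>2\<close>, so that \<open>0 \<le> T \<le> 4\<close> and \<open>|U + I|\<^sup>2 = 4 - T\<close>. On \<open>[0, 4]\<close> the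
  function \<open>t\<^sup>s + (4 - t)\<^sup>s - 4\<^sup>s\<close> with \<open>s = p / 2 \<noteq> 1\<close> has constant sign and vanishes only at the
  endpoints; by faithfulness of the trace \<open>\<parallel>U - I\<parallel>\<^sub>p\<^sup>p + \<parallel>U + I\<parallel>\<^sub>p\<^sup>p = 2\<^sup>p\<close> iff \<open>T\<close> has spectrum in
  \<open>{0, 4}\<close>, that is, iff \<open>U\<close> is self-adjoint. Moreover \<open>-I\<close> is the only unitary at distance \<open>2\<close>
  from \<open>I\<close>, so \<open>\<psi>\<close> fixes it. For \<open>p = 2\<close>, \<open>U\<close> is self-adjoint iff
  \<open>|\<parallel>W - U\<parallel>\<^sub>2\<^sup>2 - \<parallel>I - U\<parallel>\<^sub>2\<^sup>2| \<le> \<parallel>W - I\<parallel>\<^sub>2\<^sup>2\<close> for all unitaries \<open>W\<close>: the left hand side is of first order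
  in \<open>W - I\<close> unless \<open>U\<close> has no skew part.
\<close>

section \<open>Hilbert space preliminaries\<close>

instance complex_hilbert_space \<subseteq> banach ..

lemma riesz_representation:
  fixes f :: "'a::{real_inner,complete_space} \<Rightarrow> real"
  assumes "bounded_linear f"
  obtains y where "\<And>x. f x = inner y x"
proof -
  interpret f: bounded_linear f by fact
  obtain K where K: "\<And>x. norm (f x) \<le> norm x * K"
    using f.bounded by blast
  define J where "J x = inner x x - 2 * f x" for x
  have lower: "- K\<^sup>2 \<le> J x" for x
  proof -
    have "0 \<le> (norm x - K)\<^sup>2" by simp
    then have "- K\<^sup>2 \<le> inner x x - 2 * (norm x * K)"
      by (simp add: power2_diff power2_norm_eq_inner)
    also have "\<dots> \<le> J x" using K[of x] by (simp add: J_def)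
    finally show ?thesis .
  qed
  define m where "m = (INF x. J x)"
  have bdd: "bdd_below (range J)" using lower by (intro bdd_belowI2)
  have m: "m \<le> J x" for x unfolding m_def by (rule cINF_lower[OF bdd]) simp
  have "\<exists>x. J x < m + inverse (real (Suc n))" for n
    using cINF_less_iff[OF _ bdd, of "m + inverse (real (Suc n))"] by (simp add: m_def)
  then obtain X where X: "\<And>n. J (X n) < m + inverse (real (Suc n))" by metis
  have par: "(norm (x - y))\<^sup>2 \<le> 2 * (J x - m) + 2 * (J y - m)" for x y
  proof -
    have "(norm (x - y))\<^sup>2 = 2 * J x + 2 * J y - 4 * J ((1/2) *\<^sub>R (x + y))"
      by (simp add: J_def power2_norm_eq_inner f.scaleR f.add inner_simps inner_commute field_simps)
    then show ?thesis using m[of "(1/2) *\<^sub>R (x + y)"] by simp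
  qed
  have "Cauchy X"
  proof (rule metric_CauchyI)
    fix e :: real assume "0 < e"
    then obtain N where N: "inverse (real (Suc N)) < e\<^sup>2 / 4"
      using reals_Archimedean[of "e\<^sup>2 / 4"] by auto
    have "dist (X i) (X j) < e" if "N \<le> i" "N \<le> j" for i j
    proof -
      have "inverse (real (Suc i)) \<le> inverse (real (Suc N))" "inverse (real (Suc j)) \<le> inverse (real (Suc N))"
        using that by (auto intro!: le_imp_inverse_le)
      then have "(norm (X i - X j))\<^sup>2 < e\<^sup>2"
        using par[of "X i" "X j"] less_le_trans[OF X[of i], of "m + inverse (real (Suc N))"]
          less_le_trans[OF X[of j], of "m + inverse (real (Suc N))"] N by (simp del: of_nat_Suc)
      then show ?thesis
        using \<open>0 < e\<close> by (simp add: dist_norm power2_less_imp_less)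
    qed
    then show "\<exists>M. \<forall>i\<ge>M. \<forall>j\<ge>M. dist (X i) (X j) < e" by blast
  qed
  then obtain y where y: "X \<longlonglongrightarrow> y"
    using Cauchy_convergent convergent_def by blast
  have "(\<lambda>n. J (X n)) \<longlonglongrightarrow> J y"
    unfolding J_def by (intro tendsto_intros y f.tendsto)
  moreover have "(\<lambda>n. m + inverse (real (Suc n))) \<longlonglongrightarrow> m"
    using tendsto_add[OF tendsto_const LIMSEQ_inverse_real_of_nat, of m] by simp
  ultimately have Jy: "J y \<le> m"
    by (rule LIMSEQ_le) (use X in \<open>force intro: less_imp_le\<close>)
  have "f x = inner y x" for x
  proof -
    define d where "d = inner y x - f x"
    define N where "N = inner x x"
    have N: "0 \<le> N" by (simp add: N_def)
    define t where "t = - d / (N + 1)"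
    have "J y \<le> J (y + t *\<^sub>R x)" using Jy m order_trans by blast
    then have "0 \<le> 2 * t * d + t\<^sup>2 * N"
      by (simp add: J_def d_def N_def f.add f.scaleR inner_simps inner_commute power2_eq_square field_simps)
    also have "d = - t * (N + 1)" using N by (simp add: t_def)
    finally have "t\<^sup>2 * (N + 2) \<le> 0" by (simp add: power2_eq_square algebra_simps)
    then have "t = 0" using N by (simp add: mult_le_0_iff)
    then have "d = 0" using N by (simp add: t_def)
    then show ?thesis by (simp add: d_def)
  qed
  then show thesis by (rule that)
qed

lemma scaleC_minus_one: "(- 1) *\<^sub>C x = - (x::'a::complex_hilbert_space)"
  using scaleR_scaleC[of "-1" x] by simp

lemma cinner_eq_Complex:
  "cinner x y = Complex (inner x y) (- inner x (\<i> *\<^sub>C (y::'a::complex_hilbert_space)))"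
  by (simp add: inner_eq_Re_cinner cinner_scaleC_right complex_eq_iff)

lemma inner_scaleC_left:
  "inner (c *\<^sub>C x) y = inner x (cnj c *\<^sub>C (y::'a::complex_hilbert_space))"
  using cinner_commute[of "c *\<^sub>C x" y] cinner_commute[of y x]
  by (simp add: inner_eq_Re_cinner cinner_scaleC_right)

lemma bounded_ops_scaleC:
  "T \<in> bounded_ops \<Longrightarrow> blinfun_apply T (c *\<^sub>C x) = c *\<^sub>C blinfun_apply T x"
  by (simp add: bounded_ops_def)

lemma cinner_adjoint_iff:
  assumes "T \<in> bounded_ops"
  shows "(\<forall>x y. cinner (blinfun_apply S x) y = cinner x (blinfun_apply T y)) \<longleftrightarrow>
         (\<forall>x y. inner (blinfun_apply S x) y = inner x (blinfun_apply T y))"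
  using assms by (auto simp: cinner_eq_Complex bounded_ops_scaleC[symmetric])

lemma adj_eqI:
  assumes "T \<in> bounded_ops" "\<And>x y. inner (blinfun_apply S x) y = inner x (blinfun_apply T y)"
  shows "adj T = S"
  unfolding adj_def cinner_adjoint_iff[OF assms(1)]
proof (rule the_equality)
  fix S' assume "\<forall>x y. inner (blinfun_apply S' x) y = inner x (blinfun_apply T y)"
  then have "inner (blinfun_apply S' x) y = inner (blinfun_apply S x) y" for x y
    using assms(2) by simp
  then show "S' = S"
    by (intro blinfun_eqI) (metis vector_eq_rdot)
qed (use assms in auto)

lemma ex_real_adjoint:
  fixes T :: "'a::{real_inner,complete_space} \<Rightarrow>\<^sub>L 'a"
  shows "\<exists>S::'a \<Rightarrow>\<^sub>L 'a. \<forall>x y. inner (blinfun_apply S x) y = inner x (blinfun_apply T y)"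
proof -
  have "\<exists>z. \<forall>y. inner x (blinfun_apply T y) = inner z y" for x
  proof -
    have "bounded_linear (\<lambda>y. inner x (blinfun_apply T y))"
      by (intro bounded_linear_intros)
    from riesz_representation[OF this] show ?thesis by metis
  qed
  then obtain s where s: "\<And>x y. inner x (blinfun_apply T y) = inner (s x) y" by metis
  have "bounded_linear s"
  proof (rule bounded_linear_intro[where K = "norm T"])
    fix x y :: 'a and r :: real
    have "\<forall>z. inner (s (x + y)) z = inner (s x + s y) z"
      by (simp add: s[symmetric] inner_add_left)
    then show "s (x + y) = s x + s y" by (simp only: vector_eq_rdot)
    have "\<forall>z. inner (s (r *\<^sub>R x)) z = inner (r *\<^sub>R s x) z"
      by (simp add: s[symmetric])
    then show "s (r *\<^sub>R x) = r *\<^sub>R s x" by (simp only: vector_eq_rdot)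
    have "norm (s x) * norm (s x) = inner x (blinfun_apply T (s x))"
      by (simp add: s dot_square_norm power2_eq_square)
    also have "\<dots> \<le> norm x * norm (blinfun_apply T (s x))" by (rule norm_cauchy_schwarz)
    also have "\<dots> \<le> norm x * (norm T * norm (s x))"
      by (intro mult_left_mono norm_blinfun) simp
    finally show "norm (s x) \<le> norm x * norm T"
      by (cases "norm (s x) = 0") (auto simp: mult.assoc[symmetric] mult_le_cancel_right)
  qed
  then show ?thesis
    by (intro exI[of _ "Blinfun s"]) (simp add: bounded_linear_Blinfun_apply s)
qed

lemma inner_adj_left:
  assumes "T \<in> bounded_ops"
  shows "inner (blinfun_apply (adj T) x) y = inner x (blinfun_apply T y)"
proof -
  obtain S where S: "\<forall>x y. inner (blinfun_apply S x) y = inner x (blinfun_apply T y)"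
    using ex_real_adjoint by blast
  then have "adj T = S" by (intro adj_eqI assms) simp
  with S show ?thesis by simp
qed

lemma inner_adj_right:
  assumes "T \<in> bounded_ops"
  shows "inner x (blinfun_apply (adj T) y) = inner (blinfun_apply T x) y"
  using inner_adj_left[OF assms, of y x] by (simp add: inner_commute)

lemma adj_bounded_ops [simp]: "T \<in> bounded_ops \<Longrightarrow> adj T \<in> bounded_ops"
  unfolding bounded_ops_def
proof (intro CollectI allI)
  fix c x
  assume "T \<in> {T. \<forall>c x. blinfun_apply T (c *\<^sub>C x) = c *\<^sub>C blinfun_apply T x}"
  then have T: "T \<in> bounded_ops" by (simp add: bounded_ops_def)
  have "\<forall>z. inner (blinfun_apply (adj T) (c *\<^sub>C x)) z = inner (c *\<^sub>C blinfun_apply (adj T) x) z"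
    using T by (simp add: inner_adj_left inner_scaleC_left bounded_ops_scaleC)
  then show "blinfun_apply (adj T) (c *\<^sub>C x) = c *\<^sub>C blinfun_apply (adj T) x"
    by (simp only: vector_eq_rdot)
qed

lemma scaleC_scaleR: "c *\<^sub>C r *\<^sub>R x = r *\<^sub>R c *\<^sub>C (x::'a::complex_hilbert_space)"
  by (simp add: scaleR_scaleC scaleC_scaleC mult.commute)

lemma scaleC_diff_right: "c *\<^sub>C (x - y) = c *\<^sub>C x - c *\<^sub>C (y::'a::complex_hilbert_space)"
  by (rule linear_diff[OF bounded_linear.linear[OF bounded_linear_scaleC]])

lemma scaleC_zero_right: "c *\<^sub>C 0 = (0::'a::complex_hilbert_space)"
  by (rule linear_0[OF bounded_linear.linear[OF bounded_linear_scaleC]])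

lemma bounded_ops_closure [simp]:
  "id_blinfun \<in> bounded_ops" "0 \<in> bounded_ops"
  "S \<in> bounded_ops \<Longrightarrow> T \<in> bounded_ops \<Longrightarrow> S + T \<in> bounded_ops"
  "S \<in> bounded_ops \<Longrightarrow> T \<in> bounded_ops \<Longrightarrow> S - T \<in> bounded_ops"
  "S \<in> bounded_ops \<Longrightarrow> T \<in> bounded_ops \<Longrightarrow> S o\<^sub>L T \<in> bounded_ops"
  "S \<in> bounded_ops \<Longrightarrow> r *\<^sub>R S \<in> bounded_ops"
  "S \<in> bounded_ops \<Longrightarrow> - S \<in> bounded_ops"
  "scalar_op c \<in> bounded_ops"
  by (auto simp: bounded_ops_def blinfun.bilinear_simps scaleC_add_right scaleC_diff_right scaleC_scaleR
      scaleC_zero_right scaleC_scaleC mult.commute scaleC_minus_one[symmetric])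

lemma scalar_op_of_real: "scalar_op (complex_of_real r) = r *\<^sub>R id_blinfun"
  by (rule blinfun_eqI) (simp add: scaleR_scaleC blinfun.bilinear_simps)

lemma adj_simps [simp]:
  "adj id_blinfun = (id_blinfun :: 'h::complex_hilbert_space \<Rightarrow>\<^sub>L 'h)"
  "S \<in> bounded_ops \<Longrightarrow> T \<in> bounded_ops \<Longrightarrow> adj (S + T) = adj S + adj T"
  "S \<in> bounded_ops \<Longrightarrow> T \<in> bounded_ops \<Longrightarrow> adj (S - T) = adj S - adj T"
  "S \<in> bounded_ops \<Longrightarrow> T \<in> bounded_ops \<Longrightarrow> adj (S o\<^sub>L T) = adj T o\<^sub>L adj S"
  "S \<in> bounded_ops \<Longrightarrow> adj (r *\<^sub>R S) = r *\<^sub>R adj S"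
  "S \<in> bounded_ops \<Longrightarrow> adj (- S) = - adj S"
  "S \<in> bounded_ops \<Longrightarrow> adj (adj S) = S"
  by (auto intro!: adj_eqI simp: inner_adj_left inner_adj_right blinfun.bilinear_simps inner_simps)

section \<open>Hermitian operators and their spectrum\<close>

definition hermitian :: "('h::complex_hilbert_space \<Rightarrow>\<^sub>L 'h) \<Rightarrow> bool" where
  "hermitian T \<longleftrightarrow> T \<in> bounded_ops \<and> (\<forall>x y. inner (blinfun_apply T x) y = inner x (blinfun_apply T y))"

lemma hermitian_bounded_ops: "hermitian T \<Longrightarrow> T \<in> bounded_ops"
  by (simp add: hermitian_def)

lemma hermitianD: "hermitian T \<Longrightarrow> inner (blinfun_apply T x) y = inner x (blinfun_apply T y)"
  by (simp add: hermitian_def)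

lemma hermitian_iff_adj: "hermitian T \<longleftrightarrow> T \<in> bounded_ops \<and> adj T = T"
  unfolding hermitian_def using inner_adj_left by (metis adj_eqI)

lemma hermitian_closure [simp]:
  "hermitian id_blinfun" "hermitian 0"
  "hermitian S \<Longrightarrow> hermitian T \<Longrightarrow> hermitian (S + T)"
  "hermitian S \<Longrightarrow> hermitian T \<Longrightarrow> hermitian (S - T)"
  "hermitian S \<Longrightarrow> hermitian (r *\<^sub>R S)"
  by (auto simp: hermitian_def blinfun.bilinear_simps inner_simps)

lemma hermitian_adj_compose [simp]: "T \<in> bounded_ops \<Longrightarrow> hermitian (adj T o\<^sub>L T)"
  by (simp add: hermitian_def inner_adj_left inner_adj_right)

definition bounded_below :: "('a::real_normed_vector \<Rightarrow>\<^sub>L 'a) \<Rightarrow> bool" where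
  "bounded_below T \<longleftrightarrow> (\<exists>c>0. \<forall>x. c * norm x \<le> norm (blinfun_apply T x))"

lemma bounded_below_compose:
  assumes "bounded_below S" "bounded_below T"
  shows "bounded_below (S o\<^sub>L T)"
proof -
  obtain c where c: "c > 0" "\<And>x. c * norm x \<le> norm (blinfun_apply S x)"
    using assms(1) unfolding bounded_below_def by auto
  obtain d where d: "d > 0" "\<And>x. d * norm x \<le> norm (blinfun_apply T x)"
    using assms(2) unfolding bounded_below_def by auto
  have "c * d * norm x \<le> norm (blinfun_apply S (blinfun_apply T x))" for x
    using mult_left_mono[OF d(2)[of x], of c] c(1) order_trans[OF _ c(2)[of "blinfun_apply T x"]]
    by (simp add: mult.assoc)
  with c d show ?thesis
    unfolding bounded_below_def by (intro exI[of _ "c * d"]) auto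
qed

lemma hermitian_bounded_below_surj:
  fixes S :: "'h::complex_hilbert_space \<Rightarrow>\<^sub>L 'h"
  assumes S: "hermitian S" and c: "c > 0" "\<And>x. c * norm x \<le> norm (blinfun_apply S x)"
  shows "\<exists>x. blinfun_apply S x = y"
proof -
  define L where "L = (norm S)\<^sup>2 + c\<^sup>2"
  have L: "L > 0" "(norm S)\<^sup>2 \<le> L" "c\<^sup>2 \<le> L" using c by (auto simp: L_def add_nonneg_pos)
  define k where "k = 1 - c\<^sup>2 / L"
  have k: "0 \<le> k" "k < 1" using L c by (auto simp: k_def)
  define G where "G x = x - (1 / L) *\<^sub>R blinfun_apply S (blinfun_apply S x)" for x
  have G: "(norm (G x))\<^sup>2 \<le> k * (norm x)\<^sup>2" for x
  proof -
    have 1: "(norm (blinfun_apply S (blinfun_apply S x)))\<^sup>2 \<le> L * (norm (blinfun_apply S x))\<^sup>2"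
    proof -
      have "(norm (blinfun_apply S (blinfun_apply S x)))\<^sup>2 \<le> (norm S * norm (blinfun_apply S x))\<^sup>2"
        by (intro power_mono norm_blinfun) simp
      also have "\<dots> \<le> L * (norm (blinfun_apply S x))\<^sup>2"
        using L by (simp add: power_mult_distrib mult_right_mono)
      finally show ?thesis .
    qed
    have 2: "c\<^sup>2 * (norm x)\<^sup>2 \<le> (norm (blinfun_apply S x))\<^sup>2"
      using power_mono[OF c(2)[of x], of 2] c(1) by (simp add: power_mult_distrib)
    have "(norm (G x))\<^sup>2 = (norm x)\<^sup>2 - 2 / L * (norm (blinfun_apply S x))\<^sup>2
        + (norm (blinfun_apply S (blinfun_apply S x)))\<^sup>2 / L\<^sup>2"
      using hermitianD[OF S] by (simp add: G_def power2_norm_eq_inner inner_simps inner_commute)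
        (simp add: power2_eq_square)
    also have "\<dots> \<le> (norm x)\<^sup>2 - 2 / L * (norm (blinfun_apply S x))\<^sup>2
        + L * (norm (blinfun_apply S x))\<^sup>2 / L\<^sup>2"
      using 1 by (intro add_left_mono divide_right_mono) auto
    also have "\<dots> = (norm x)\<^sup>2 - (norm (blinfun_apply S x))\<^sup>2 / L"
      using L by (simp add: power2_eq_square field_simps)
    also have "\<dots> \<le> (norm x)\<^sup>2 - c\<^sup>2 * (norm x)\<^sup>2 / L"
      using 2 L by (intro diff_left_mono divide_right_mono) auto
    also have "\<dots> = k * (norm x)\<^sup>2" by (simp add: k_def algebra_simps)
    finally show ?thesis .
  qed
  have "\<exists>!x. G x + (1 / L) *\<^sub>R y = x"
  proof (rule banach_fix_type[of "sqrt k"])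
    show "\<forall>u v. dist (G u + (1 / L) *\<^sub>R y) (G v + (1 / L) *\<^sub>R y) \<le> sqrt k * dist u v"
    proof (intro allI)
      fix u v
      have "G u - G v = G (u - v)" by (simp add: G_def blinfun.bilinear_simps algebra_simps)
      moreover have "norm (G (u - v)) \<le> sqrt (k * (norm (u - v))\<^sup>2)"
        using G by (rule real_le_rsqrt)
      ultimately show "dist (G u + (1 / L) *\<^sub>R y) (G v + (1 / L) *\<^sub>R y) \<le> sqrt k * dist u v"
        using k by (simp add: dist_norm real_sqrt_mult)
    qed
  qed (use k in auto)
  then obtain x where "G x + (1 / L) *\<^sub>R y = x" by blast
  then have "(1 / L) *\<^sub>R y = (1 / L) *\<^sub>R blinfun_apply S (blinfun_apply S x)"
    by (simp add: G_def algebra_simps)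
  then have "blinfun_apply S (blinfun_apply S x) = y" using L(1) by simp
  then show ?thesis by blast
qed

lemma bounded_below_invertible:
  fixes S :: "'h::complex_hilbert_space \<Rightarrow>\<^sub>L 'h"
  assumes S: "hermitian S" and bb: "bounded_below S"
  shows "\<exists>R\<in>bounded_ops. R o\<^sub>L S = id_blinfun \<and> S o\<^sub>L R = id_blinfun"
proof -
  obtain c where c: "c > 0" "\<And>x. c * norm x \<le> norm (blinfun_apply S x)"
    using bb unfolding bounded_below_def by auto
  obtain r where r: "\<And>y. blinfun_apply S (r y) = y"
    using hermitian_bounded_below_surj[OF S c] by metis
  have inj: "x = y" if "blinfun_apply S x = blinfun_apply S y" for x y
  proof -
    have "blinfun_apply S (x - y) = 0" using that by (simp add: blinfun.diff_right)
    then have "c * norm (x - y) \<le> 0" using c(2)[of "x - y"] by simp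
    then show ?thesis using c(1) by (simp add: mult_le_0_iff)
  qed
  have "bounded_linear r"
  proof (rule bounded_linear_intro[where K = "1 / c"])
    show "norm (r x) \<le> norm x * (1 / c)" for x
      using c(2)[of "r x"] c(1) by (simp add: r field_simps)
  qed (rule inj, simp add: r blinfun.add_right blinfun.scaleR_right)+
  then have R: "blinfun_apply (Blinfun r) = r" by (rule bounded_linear_Blinfun_apply)
  show ?thesis
  proof (rule bexI[of _ "Blinfun r"], intro conjI)
    show "Blinfun r o\<^sub>L S = id_blinfun"
      by (rule blinfun_eqI, simp add: R, rule inj, simp add: r)
    show "S o\<^sub>L Blinfun r = id_blinfun"
      by (rule blinfun_eqI) (simp add: R r)
    have "r (c *\<^sub>C x) = c *\<^sub>C r x" for c x
      by (rule inj) (simp add: r bounded_ops_scaleC[OF hermitian_bounded_ops[OF S]])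
    then show "Blinfun r \<in> bounded_ops"
      by (simp add: bounded_ops_def R)
  qed
qed

definition real_spectrum :: "('h::complex_hilbert_space \<Rightarrow>\<^sub>L 'h) \<Rightarrow> real set" where
  "real_spectrum T = {t. complex_of_real t \<in> op_spectrum T}"

lemma real_spectrum_iff:
  assumes "hermitian T"
  shows "t \<in> real_spectrum T \<longleftrightarrow> \<not> bounded_below (T - t *\<^sub>R id_blinfun)"
proof -
  have "bounded_below (T - t *\<^sub>R id_blinfun)"
    if S: "S o\<^sub>L (T - t *\<^sub>R id_blinfun) = id_blinfun" for S
  proof -
    have "1 / (norm S + 1) * norm x \<le> norm (blinfun_apply (T - t *\<^sub>R id_blinfun) x)" for x
    proof -
      have "norm x = norm (blinfun_apply (S o\<^sub>L (T - t *\<^sub>R id_blinfun)) x)" by (simp add: S)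
      also have "\<dots> \<le> norm S * norm (blinfun_apply (T - t *\<^sub>R id_blinfun) x)"
        by (simp add: norm_blinfun)
      also have "\<dots> \<le> (norm S + 1) * norm (blinfun_apply (T - t *\<^sub>R id_blinfun) x)"
        by (intro mult_right_mono) auto
      finally show ?thesis by (simp add: field_simps add_pos_nonneg)
    qed
    then show ?thesis
      unfolding bounded_below_def by (intro exI[of _ "1 / (norm S + 1)"]) (auto simp: add_nonneg_pos)
  qed
  moreover have "\<exists>S\<in>bounded_ops. S o\<^sub>L (T - t *\<^sub>R id_blinfun) = id_blinfun \<and>
      (T - t *\<^sub>R id_blinfun) o\<^sub>L S = id_blinfun" if "bounded_below (T - t *\<^sub>R id_blinfun)"
    by (rule bounded_below_invertible) (use assms that in auto)
  ultimately show ?thesis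
    unfolding real_spectrum_def op_spectrum_def by (auto simp: scalar_op_of_real)
qed

section \<open>Polynomials in an operator\<close>

lemma blinfun_compose_id [simp]: "T o\<^sub>L id_blinfun = T" "id_blinfun o\<^sub>L T = T"
  by (auto intro: blinfun_eqI)

lemma op_power_simps: "op_power T 0 = id_blinfun" "op_power T (Suc n) = T o\<^sub>L op_power T n"
  by (simp_all add: op_power_def)

lemma op_poly_altdef:
  assumes "degree q \<le> n"
  shows "op_poly q T = (\<Sum>i\<le>n. coeff q i *\<^sub>R op_power T i)"
  unfolding op_poly_def
  by (rule sum.mono_neutral_left) (use assms in \<open>auto simp: coeff_eq_0\<close>)

lemma op_poly_0 [simp]: "op_poly 0 T = 0"
  by (simp add: op_poly_def)

lemma op_poly_pCons [simp]: "op_poly (pCons c q) T = c *\<^sub>R id_blinfun + (T o\<^sub>L op_poly q T)"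
proof -
  have "op_poly (pCons c q) T = (\<Sum>i\<le>Suc (degree q). coeff (pCons c q) i *\<^sub>R op_power T i)"
    by (rule op_poly_altdef) (rule degree_pCons_le)
  also have "\<dots> = c *\<^sub>R id_blinfun + (\<Sum>i\<le>degree q. coeff q i *\<^sub>R (T o\<^sub>L op_power T i))"
    by (subst sum.atMost_Suc_shift) (simp add: op_power_simps)
  also have "(\<Sum>i\<le>degree q. coeff q i *\<^sub>R (T o\<^sub>L op_power T i)) = T o\<^sub>L op_poly q T"
    by (simp add: op_poly_def bounded_bilinear.sum_right[OF bounded_bilinear_blinfun_compose]
        bounded_bilinear.scaleR_right[OF bounded_bilinear_blinfun_compose])
  finally show ?thesis .
qed

lemma op_poly_const: "op_poly [:c:] T = c *\<^sub>R id_blinfun"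
  by (simp add: op_poly_def op_power_simps)

lemma op_poly_add: "op_poly (p + q) T = op_poly p T + op_poly q T"
proof -
  define n where "n = max (degree p) (degree q)"
  have "degree (p + q) \<le> n" "degree p \<le> n" "degree q \<le> n"
    by (auto simp: n_def degree_add_le_max)
  then show ?thesis
    by (simp add: op_poly_altdef scaleR_add_left sum.distrib)
qed

lemma op_poly_smult: "op_poly (smult c p) T = c *\<^sub>R op_poly p T"
  using degree_smult_le[of c p] by (simp add: op_poly_altdef[of _ "degree p"] scaleR_sum_right)

lemma op_poly_diff: "op_poly (p - q) T = op_poly p T - op_poly q T"
  using op_poly_add[of p "smult (- 1) q" T] op_poly_smult[of "- 1" q T] by simp

lemma op_poly_mult: "op_poly (p * q) T = op_poly p T o\<^sub>L op_poly q T"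
proof (induction p)
  case (pCons a p)
  show ?case
    by (rule blinfun_eqI) (simp add: pCons op_poly_add op_poly_smult blinfun.bilinear_simps)
qed simp

lemma commutant_iff:
  "T \<in> commutant A \<longleftrightarrow> T \<in> bounded_ops \<and> (\<forall>B\<in>A. \<forall>x. blinfun_apply T (blinfun_apply B x) = blinfun_apply B (blinfun_apply T x))"
  by (auto simp: commutant_def blinfun_apply_inject[symmetric] fun_eq_iff)

lemma commutant_bounded_ops: "T \<in> commutant A \<Longrightarrow> T \<in> bounded_ops"
  by (simp add: commutant_def)

lemma commutant_closure [simp]:
  assumes "A \<subseteq> bounded_ops"
  shows "id_blinfun \<in> commutant A" "0 \<in> commutant A"
    "S \<in> commutant A \<Longrightarrow> T \<in> commutant A \<Longrightarrow> S + T \<in> commutant A"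
    "S \<in> commutant A \<Longrightarrow> T \<in> commutant A \<Longrightarrow> S - T \<in> commutant A"
    "S \<in> commutant A \<Longrightarrow> T \<in> commutant A \<Longrightarrow> S o\<^sub>L T \<in> commutant A"
    "S \<in> commutant A \<Longrightarrow> r *\<^sub>R S \<in> commutant A"
    "S \<in> commutant A \<Longrightarrow> - S \<in> commutant A"
  using assms by (auto simp: commutant_iff blinfun.bilinear_simps)

lemma commutant_closed:
  assumes "\<And>n. X n \<in> commutant A" "X \<longlonglongrightarrow> S"
  shows "S \<in> commutant A"
proof -
  have lim: "(\<lambda>n. blinfun_apply (X n) x) \<longlonglongrightarrow> blinfun_apply S x" for x
    by (intro blinfun.tendsto assms tendsto_const)
  have "blinfun_apply S (c *\<^sub>C x) = c *\<^sub>C blinfun_apply S x" for c x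
  proof (rule LIMSEQ_unique[OF lim])
    show "(\<lambda>n. blinfun_apply (X n) (c *\<^sub>C x)) \<longlonglongrightarrow> c *\<^sub>C blinfun_apply S x"
      using bounded_linear.tendsto[OF bounded_linear_scaleC lim]
      by (simp add: bounded_ops_scaleC[OF commutant_bounded_ops[OF assms(1)]])
  qed
  moreover have "blinfun_apply S (blinfun_apply B x) = blinfun_apply B (blinfun_apply S x)"
    if "B \<in> A" for B x
  proof (rule LIMSEQ_unique[OF lim])
    show "(\<lambda>n. blinfun_apply (X n) (blinfun_apply B x)) \<longlonglongrightarrow> blinfun_apply B (blinfun_apply S x)"
      using blinfun.tendsto[OF tendsto_const[of B] lim[of x]] assms(1) that
      by (simp add: commutant_iff)
  qed
  ultimately show ?thesis by (simp add: commutant_iff bounded_ops_def)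
qed

lemma op_poly_commutant:
  assumes "A \<subseteq> bounded_ops" "T \<in> commutant A"
  shows "op_poly q T \<in> commutant A"
  by (induction q) (use assms in simp_all)

lemma op_poly_commute:
  assumes "T \<in> bounded_ops"
  shows "blinfun_apply (op_poly q T) (blinfun_apply T x) = blinfun_apply T (blinfun_apply (op_poly q T) x)"
  using op_poly_commutant[of "{T}" T q] assms by (simp add: commutant_iff)

lemma hermitian_op_poly:
  assumes "hermitian T"
  shows "hermitian (op_poly q T)"
proof (induction q)
  case (pCons c q)
  have "hermitian (T o\<^sub>L op_poly q T)"
    using assms pCons by (simp add: hermitian_def op_poly_commute)
  then show ?case by simp
qed simp

lemma real_poly_root_or_quadratic_factor:
  fixes r :: "real poly"
  assumes "degree r > 0"
  obtains t where "poly r t = 0"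
  | a b q where "b \<noteq> 0" "r = [:a\<^sup>2 + b\<^sup>2, - 2 * a, 1:] * q"
proof -
  define C where "C = map_poly complex_of_real"
  have C_simps: "C 0 = 0" "C (pCons c p) = pCons (complex_of_real c) (C p)" for c p
    by (simp_all add: C_def map_poly_pCons)
  have C_add: "C (p + q) = C p + C q" for p q
    by (rule poly_eqI) (simp add: C_def coeff_map_poly)
  have C_smult: "C (smult c p) = smult (complex_of_real c) (C p)" for c p
    by (rule poly_eqI) (simp add: C_def coeff_map_poly)
  have C_mult: "C (p * q) = C p * C q" for p q
    by (induction p) (simp_all add: C_simps C_add C_smult)
  have C_real: "poly (C p) (complex_of_real t) = complex_of_real (poly p t)" for p t
    by (induction p) (simp_all add: C_simps)
  have "degree (C r) = degree r" unfolding C_def by (rule degree_map_poly) simp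
  then have "\<not> constant (poly (C r))" using assms by (simp add: constant_degree)
  then obtain z where z: "poly (C r) z = 0"
    using fundamental_theorem_of_algebra by blast
  obtain a b where ab: "z = Complex a b" by (cases z)
  show thesis
  proof (cases "b = 0")
    case True
    then have "z = complex_of_real a" by (simp add: ab complex_of_real_def)
    then have "poly r a = 0" using z by (simp add: C_real)
    then show thesis by (rule that)
  next
    case False
    define m where "m = [:a\<^sup>2 + b\<^sup>2, - 2 * a, 1:]"
    have m0: "poly (C m) z = 0"
      by (simp add: m_def C_simps ab complex_eq_iff power2_eq_square algebra_simps)
    have "degree m = 2" "m \<noteq> 0" by (simp_all add: m_def)
    then have deg: "r mod m = 0 \<or> degree (r mod m) < 2" using degree_mod_less[of m r] by auto
    obtain u v s where uv: "r mod m = pCons u (pCons v s)" by (metis pCons_cases)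
    with deg have "s = 0" by (auto split: if_splits)
    with uv have uv: "r mod m = [:u, v:]" by simp
    have "r = m * (r div m) + [:u, v:]" using uv by (metis mult_div_mod_eq)
    then have "poly (C r) z = poly (C m) z * poly (C (r div m)) z + poly (C [:u, v:]) z"
      by (metis C_add C_mult poly_add poly_mult)
    then have "poly (C [:u, v:]) z = 0" using z m0 by simp
    then have "u + a * v = 0" "b * v = 0" by (simp_all add: C_simps ab complex_eq_iff)
    then have "r mod m = 0" using uv False by simp
    then have "r = m * (r div m)" by (metis add.right_neutral mult_div_mod_eq)
    then show thesis using that(2)[OF False] unfolding m_def by blast
  qed
qed

lemma bounded_below_quadratic:
  assumes T: "hermitian T" and b: "b \<noteq> 0"
  shows "bounded_below (op_poly [:a\<^sup>2 + b\<^sup>2, - 2 * a, 1:] T)" (is "bounded_below ?Q")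
proof -
  have "b\<^sup>2 * norm x \<le> norm (blinfun_apply ?Q x)" for x
  proof -
    let ?y = "blinfun_apply T x - a *\<^sub>R x"
    have "inner x (blinfun_apply ?Q x) = inner ?y ?y + b\<^sup>2 * inner x x"
      by (simp add: blinfun.bilinear_simps inner_simps inner_commute[of "blinfun_apply T x" x]
          hermitianD[OF T, of x "blinfun_apply T x"] power2_eq_square algebra_simps)
    then have "b\<^sup>2 * (norm x * norm x) \<le> inner x (blinfun_apply ?Q x)"
      by (simp add: dot_square_norm power2_eq_square)
    also have "\<dots> \<le> norm x * norm (blinfun_apply ?Q x)" by (rule norm_cauchy_schwarz)
    finally have "norm x * (b\<^sup>2 * norm x) \<le> norm x * norm (blinfun_apply ?Q x)"
      by (simp add: mult_ac)
    then show ?thesis by (cases "x = 0") (simp_all add: mult_le_cancel_left)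
  qed
  then show ?thesis unfolding bounded_below_def using b by (intro exI[of _ "b\<^sup>2"]) auto
qed

lemma bounded_below_op_poly:
  assumes T: "hermitian T"
  shows "r \<noteq> 0 \<Longrightarrow> (\<And>t. t \<in> real_spectrum T \<Longrightarrow> poly r t \<noteq> 0) \<Longrightarrow> bounded_below (op_poly r T)"
proof (induction "degree r" arbitrary: r rule: less_induct)
  case less
  show ?case
  proof (cases "degree r = 0")
    case True
    then obtain c where r: "r = [:c:]" by (metis degree_0_id)
    then show ?thesis using less.prems(1) unfolding bounded_below_def
      by (intro exI[of _ "\<bar>c\<bar>"]) (auto simp: blinfun.scaleR_left)
  next
    case False
    then have "degree r > 0" by simp
    then show ?thesis
    proof (cases rule: real_poly_root_or_quadratic_factor)
      case (1 t)
      then obtain q where q: "r = [:- t, 1:] * q" by (auto simp: poly_eq_0_iff_dvd elim: dvdE)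
      have "q \<noteq> 0" using q less.prems(1) by auto
      then have "degree r = Suc (degree q)" unfolding q by (subst degree_mult_eq) auto
      moreover have "poly q s \<noteq> 0" if "s \<in> real_spectrum T" for s
        using less.prems(2)[OF that] q by auto
      ultimately have "bounded_below (op_poly q T)" using less.hyps[of q] \<open>q \<noteq> 0\<close> by simp
      moreover have "t \<notin> real_spectrum T" using 1 less.prems(2) by blast
      then have "bounded_below (op_poly [:- t, 1:] T)"
        using T by (simp add: real_spectrum_iff)
      ultimately show ?thesis unfolding q op_poly_mult by (intro bounded_below_compose)
    next
      case (2 b a q)
      have "q \<noteq> 0" using 2 less.prems(1) by auto
      then have "degree r = 2 + degree q" unfolding 2 by (subst degree_mult_eq) auto
      moreover have "poly q s \<noteq> 0" if "s \<in> real_spectrum T" for s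
        using less.prems(2)[OF that] 2 by auto
      ultimately have "bounded_below (op_poly q T)" using less.hyps[of q] \<open>q \<noteq> 0\<close> by simp
      then show ?thesis unfolding 2 op_poly_mult
        by (intro bounded_below_compose bounded_below_quadratic T 2)
    qed
  qed
qed

lemma norm_or_minus_norm_not_bounded_below:
  assumes S: "hermitian S" and "S \<noteq> 0"
  shows "\<not> bounded_below (S - norm S *\<^sub>R id_blinfun) \<or> \<not> bounded_below (S + norm S *\<^sub>R id_blinfun)"
proof (rule ccontr)
  define L where "L = norm S"
  assume "\<not> ?thesis"
  then have "bounded_below ((S - L *\<^sub>R id_blinfun) o\<^sub>L (S + L *\<^sub>R id_blinfun))" (is "bounded_below ?D")
    by (intro bounded_below_compose) (auto simp: L_def)
  then obtain c where c: "c > 0" "\<And>x. c * norm x \<le> norm (blinfun_apply ?D x)"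
    unfolding bounded_below_def by auto
  have L: "L > 0" using \<open>S \<noteq> 0\<close> by (simp add: L_def)
  define k where "k = max 0 (L\<^sup>2 - c\<^sup>2 / L\<^sup>2)"
  have "(norm (blinfun_apply S x))\<^sup>2 \<le> k * (norm x)\<^sup>2" for x
  proof -
    have D: "blinfun_apply ?D x = blinfun_apply S (blinfun_apply S x) - L\<^sup>2 *\<^sub>R x"
      by (simp add: blinfun.bilinear_simps power2_eq_square scaleR_diff_right)
    have "(norm (blinfun_apply ?D x))\<^sup>2 = (norm (blinfun_apply S (blinfun_apply S x)))\<^sup>2
        - 2 * L\<^sup>2 * (norm (blinfun_apply S x))\<^sup>2 + L\<^sup>2 * (L\<^sup>2 * (norm x)\<^sup>2)"
      unfolding D using hermitianD[OF S] by (simp add: power2_norm_eq_inner inner_simps inner_commute)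
    also have "(norm (blinfun_apply S (blinfun_apply S x)))\<^sup>2 \<le> (L * norm (blinfun_apply S x))\<^sup>2"
      unfolding L_def by (intro power_mono norm_blinfun) simp
    finally have "(norm (blinfun_apply ?D x))\<^sup>2 \<le> L\<^sup>2 * (L\<^sup>2 * (norm x)\<^sup>2 - (norm (blinfun_apply S x))\<^sup>2)"
      by (simp add: power_mult_distrib algebra_simps)
    moreover have "c\<^sup>2 * (norm x)\<^sup>2 \<le> (norm (blinfun_apply ?D x))\<^sup>2"
      using power_mono[OF c(2)[of x], of 2] c(1) by (simp add: power_mult_distrib)
    ultimately have "c\<^sup>2 * (norm x)\<^sup>2 / L\<^sup>2 \<le> L\<^sup>2 * (norm x)\<^sup>2 - (norm (blinfun_apply S x))\<^sup>2"
      using L by (subst pos_divide_le_eq) (auto simp: mult.commute)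
    then have "(norm (blinfun_apply S x))\<^sup>2 \<le> (L\<^sup>2 - c\<^sup>2 / L\<^sup>2) * (norm x)\<^sup>2"
      by (simp add: algebra_simps)
    also have "\<dots> \<le> k * (norm x)\<^sup>2" by (intro mult_right_mono) (auto simp: k_def)
    finally show ?thesis .
  qed
  then have "norm (blinfun_apply S x) \<le> sqrt k * norm x" for x
    using real_le_rsqrt[of "norm (blinfun_apply S x)" "k * (norm x)\<^sup>2"] by (simp add: real_sqrt_mult)
  then have "L \<le> sqrt k" unfolding L_def by (intro norm_blinfun_bound) (auto simp: k_def)
  then have "L\<^sup>2 \<le> k" using L by (metis less_imp_le real_sqrt_le_iff real_sqrt_unique)
  moreover have "0 < c\<^sup>2 / L\<^sup>2" using L c(1) by simp
  ultimately show False using L by (auto simp: k_def max_def split: if_splits)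
qed

lemma real_spectrum_nonempty:
  assumes T: "hermitian T" and "x \<noteq> (0::'h::complex_hilbert_space)"
  shows "real_spectrum (T :: 'h \<Rightarrow>\<^sub>L 'h) \<noteq> {}"
proof (cases "T = 0")
  case True
  have "\<not> bounded_below (0 :: 'h \<Rightarrow>\<^sub>L 'h)"
    using assms(2) by (auto simp: bounded_below_def mult_le_0_iff not_le)
  then have "0 \<in> real_spectrum T" using T True by (simp add: real_spectrum_iff)
  then show ?thesis by auto
next
  case False
  from norm_or_minus_norm_not_bounded_below[OF T False]
  have "norm T \<in> real_spectrum T \<or> - norm T \<in> real_spectrum T"
    by (simp add: real_spectrum_iff[OF T])
  then show ?thesis by auto
qed

lemma norm_op_poly_le:
  assumes T: "hermitian T" and c: "0 \<le> c" "\<And>t. t \<in> real_spectrum T \<Longrightarrow> \<bar>poly q t\<bar> \<le> c"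
  shows "norm (op_poly q T) \<le> c"
proof (rule ccontr)
  define S where "S = op_poly q T"
  assume "\<not> ?thesis"
  then have L: "c < norm S" by (simp add: S_def)
  then have "S \<noteq> 0" using c(1) by auto
  then obtain x where "blinfun_apply S x \<noteq> 0" by (metis blinfun_eqI blinfun.zero_left)
  then have "x \<noteq> 0" by auto
  then obtain t where t: "t \<in> real_spectrum T" using real_spectrum_nonempty[OF T] by blast
  have "bounded_below (op_poly (q - [:l:]) T)" if "\<bar>l\<bar> = norm S" for l
  proof (rule bounded_below_op_poly[OF T])
    show nz: "poly (q - [:l:]) s \<noteq> 0" if "s \<in> real_spectrum T" for s
      using c(2)[OF that] L \<open>\<bar>l\<bar> = norm S\<close> by auto
    show "q - [:l:] \<noteq> 0" using nz[OF t] by auto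
  qed
  from this[of "norm S"] this[of "- norm S"]
  have "bounded_below (S - norm S *\<^sub>R id_blinfun)" "bounded_below (S + norm S *\<^sub>R id_blinfun)"
    by (auto simp: op_poly_diff op_poly_const S_def)
  moreover have "hermitian S" unfolding S_def by (rule hermitian_op_poly[OF T])
  ultimately show False using norm_or_minus_norm_not_bounded_below[OF _ \<open>S \<noteq> 0\<close>] by blast
qed

lemma abs_poly_le_norm_op_poly:
  assumes T: "hermitian T" and t: "t \<in> real_spectrum T"
  shows "\<bar>poly q t\<bar> \<le> norm (op_poly q T)"
proof (rule ccontr)
  assume "\<not> ?thesis"
  then have L: "norm (op_poly q T) < \<bar>poly q t\<bar>" by simp
  have "poly (q - [:poly q t:]) t = 0" by simp
  then obtain r where "q - [:poly q t:] = [:- t, 1:] * r"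
    unfolding poly_eq_0_iff_dvd by (auto elim: dvdE)
  then have "op_poly (q - [:poly q t:]) T = op_poly (r * [:- t, 1:]) T"
    by (simp only: mult.commute)
  then have eq: "op_poly q T - poly q t *\<^sub>R id_blinfun = op_poly r T o\<^sub>L (T - t *\<^sub>R id_blinfun)"
    by (simp only: op_poly_mult op_poly_diff op_poly_const) simp
  define d where "d = \<bar>poly q t\<bar> - norm (op_poly q T)"
  define M where "M = norm (op_poly r T) + 1"
  have pos: "d > 0" "M > 0" using L by (auto simp: d_def M_def add_nonneg_pos)
  have "d / M * norm x \<le> norm (blinfun_apply (T - t *\<^sub>R id_blinfun) x)" (is "_ \<le> norm ?y") for x
  proof -
    have "\<bar>poly q t\<bar> * norm x - norm (op_poly q T) * norm x
        \<le> norm (poly q t *\<^sub>R x) - norm (blinfun_apply (op_poly q T) x)"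
      by (simp add: norm_blinfun)
    also have "\<dots> \<le> norm (blinfun_apply (op_poly q T) x - poly q t *\<^sub>R x)"
      by (metis norm_minus_commute norm_triangle_ineq2)
    also have "\<dots> = norm (blinfun_apply (op_poly r T) ?y)"
      using arg_cong[OF eq, of "\<lambda>A. blinfun_apply A x"] by (simp add: blinfun.bilinear_simps)
    also have "\<dots> \<le> norm (op_poly r T) * norm ?y" by (rule norm_blinfun)
    also have "\<dots> \<le> M * norm ?y" by (intro mult_right_mono) (auto simp: M_def)
    finally show ?thesis using pos by (simp add: d_def field_simps)
  qed
  then have "bounded_below (T - t *\<^sub>R id_blinfun)"
    unfolding bounded_below_def using pos by (intro exI[of _ "d / M"]) auto
  with t show False by (simp add: real_spectrum_iff[OF T])
qed

lemma real_spectrum_bounds: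
  assumes T: "hermitian T"
    and "\<And>x. a * inner x x \<le> inner x (blinfun_apply T x)"
    and "\<And>x. inner x (blinfun_apply T x) \<le> b * inner x x"
  shows "real_spectrum T \<subseteq> {a..b}"
proof -
  have bb: "bounded_below S" if S: "c > 0" "\<And>x. c * inner x x \<le> \<bar>inner x (blinfun_apply S x)\<bar>" for c and S :: "'a \<Rightarrow>\<^sub>L 'a"
  proof -
    have "c * norm x \<le> norm (blinfun_apply S x)" for x
    proof -
      have "norm x * (c * norm x) = c * inner x x" by (simp add: dot_square_norm power2_eq_square)
      also have "\<dots> \<le> norm x * norm (blinfun_apply S x)"
        using S(2)[of x] Cauchy_Schwarz_ineq2[of x "blinfun_apply S x"] by linarith
      finally show ?thesis by (cases "x = 0") (simp_all add: mult_le_cancel_left)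
    qed
    with S(1) show ?thesis unfolding bounded_below_def by blast
  qed
  have "\<not> t < a" if "t \<in> real_spectrum T" for t
  proof
    assume "t < a"
    then have "bounded_below (T - t *\<^sub>R id_blinfun)"
    proof (intro bb[of "a - t"])
      show "(a - t) * inner x x \<le> \<bar>inner x (blinfun_apply (T - t *\<^sub>R id_blinfun) x)\<bar>" for x
        using assms(2)[of x] by (simp add: blinfun.bilinear_simps inner_simps left_diff_distrib)
    qed simp
    with that show False by (simp add: real_spectrum_iff[OF T])
  qed
  moreover have "\<not> b < t" if "t \<in> real_spectrum T" for t
  proof
    assume "b < t"
    then have "bounded_below (T - t *\<^sub>R id_blinfun)"
    proof (intro bb[of "t - b"])
      show "(t - b) * inner x x \<le> \<bar>inner x (blinfun_apply (T - t *\<^sub>R id_blinfun) x)\<bar>" for x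
        using assms(3)[of x] by (simp add: blinfun.bilinear_simps inner_simps left_diff_distrib)
    qed simp
    with that show False by (simp add: real_spectrum_iff[OF T])
  qed
  ultimately show ?thesis by (auto simp: not_less)
qed

section \<open>Continuous functional calculus\<close>

lemma weierstrass_uniform_limit:
  fixes f :: "real \<Rightarrow> real"
  assumes "continuous_on {a..b} f"
  obtains q where "uniform_limit {a..b} (\<lambda>n. poly (q n)) f sequentially"
proof -
  have "\<exists>q. \<forall>x\<in>{a..b}. \<bar>f x - poly q x\<bar> < e" if e: "0 < e" for e
  proof -
    obtain g where g: "real_polynomial_function g" "\<And>x. x \<in> {a..b} \<Longrightarrow> \<bar>f x - g x\<bar> < e"
      using Stone_Weierstrass_real_polynomial_function[OF compact_Icc assms e] by blast
    from g(1) obtain c n where "g = (\<lambda>x. \<Sum>i\<le>n. c i * x ^ i)"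
      unfolding real_polynomial_function_iff_sum by blast
    then have "g = poly (\<Sum>i\<le>n. monom (c i) i)" by (simp add: poly_sum poly_monom fun_eq_iff)
    with g(2) show ?thesis by blast
  qed
  then have "\<exists>q. \<forall>x\<in>{a..b}. \<bar>f x - poly q x\<bar> < inverse (real (Suc n))" for n
    by simp
  then obtain q where q: "\<And>n x. x \<in> {a..b} \<Longrightarrow> \<bar>f x - poly (q n) x\<bar> < inverse (real (Suc n))"
    by metis
  have "uniform_limit {a..b} (\<lambda>n. poly (q n)) f sequentially"
  proof (rule uniform_limitI)
    fix e :: real assume "0 < e"
    then have "\<forall>\<^sub>F n in sequentially. inverse (real (Suc n)) < e"
      by (rule order_tendstoD(2)[OF LIMSEQ_inverse_real_of_nat])
    then show "\<forall>\<^sub>F n in sequentially. \<forall>x\<in>{a..b}. dist (poly (q n) x) (f x) < e"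
      by eventually_elim (auto simp: dist_real_def abs_minus_commute intro: less_trans[OF q])
  qed
  then show thesis by (rule that)
qed

lemma uniform_limit_op_poly_Cauchy:
  assumes T: "hermitian T" and e: "0 < e"
    and p: "uniform_limit (real_spectrum T) (\<lambda>n. poly (p n)) f sequentially"
    and q: "uniform_limit (real_spectrum T) (\<lambda>n. poly (q n)) f sequentially"
  shows "\<exists>N. \<forall>m\<ge>N. \<forall>n\<ge>N. norm (op_poly (p m) T - op_poly (q n) T) < e"
proof -
  have e3: "0 < e / 3" using e by simp
  obtain N where N: "\<And>n t. N \<le> n \<Longrightarrow> t \<in> real_spectrum T \<Longrightarrow> dist (poly (p n) t) (f t) < e / 3"
    using uniform_limitD[OF p e3] by (auto simp: eventually_sequentially)
  obtain M where M: "\<And>n t. M \<le> n \<Longrightarrow> t \<in> real_spectrum T \<Longrightarrow> dist (poly (q n) t) (f t) < e / 3"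
    using uniform_limitD[OF q e3] by (auto simp: eventually_sequentially)
  have "norm (op_poly (p m - q n) T) \<le> 2 * e / 3" if "max N M \<le> m" "max N M \<le> n" for m n
  proof (rule norm_op_poly_le[OF T])
    fix t assume "t \<in> real_spectrum T"
    then show "\<bar>poly (p m - q n) t\<bar> \<le> 2 * e / 3"
      using N[of m t] M[of n t] that dist_triangle2[of "poly (p m) t" "poly (q n) t" "f t"]
      by (simp add: dist_real_def)
  qed (use e in simp)
  then have "norm (op_poly (p m) T - op_poly (q n) T) < e" if "max N M \<le> m" "max N M \<le> n" for m n
    using that e by (force simp: op_poly_diff intro: le_less_trans[of _ "2 * e / 3"])
  then show ?thesis by blast
qed

lemma cfc_cong:
  assumes "\<And>t. t \<in> real_spectrum T \<Longrightarrow> f t = g t"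
  shows "cfc f T = cfc g T"
proof -
  have "uniform_limit (real_spectrum T) (\<lambda>n. poly (q n)) f sequentially \<longleftrightarrow>
      uniform_limit (real_spectrum T) (\<lambda>n. poly (q n)) g sequentially" for q :: "nat \<Rightarrow> real poly"
    by (rule uniform_limit_cong') (use assms in auto)
  then show ?thesis by (simp add: cfc_def real_spectrum_def)
qed

lemma cfc_tendsto:
  assumes T: "hermitian T"
    and q: "uniform_limit (real_spectrum T) (\<lambda>n. poly (q n)) f sequentially"
  shows "(\<lambda>n. op_poly (q n) T) \<longlonglongrightarrow> cfc f T"
proof -
  have "Cauchy (\<lambda>n. op_poly (q n) T)"
    by (rule CauchyI) (use uniform_limit_op_poly_Cauchy[OF T _ q q] in blast)
  then obtain S where S: "(\<lambda>n. op_poly (q n) T) \<longlonglongrightarrow> S"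
    using Cauchy_convergent convergent_def by blast
  have "(\<lambda>n. op_poly (p n) T) \<longlonglongrightarrow> S"
    if p: "uniform_limit (real_spectrum T) (\<lambda>n. poly (p n)) f sequentially" for p
  proof -
    have "(\<lambda>n. op_poly (p n) T - op_poly (q n) T) \<longlonglongrightarrow> 0"
    proof (rule LIMSEQ_I)
      fix e :: real assume "0 < e"
      from uniform_limit_op_poly_Cauchy[OF T this p q]
      show "\<exists>N. \<forall>n\<ge>N. norm (op_poly (p n) T - op_poly (q n) T - 0) < e" by auto
    qed
    from tendsto_add[OF this S] show ?thesis by simp
  qed
  then have "cfc f T = S"
    unfolding cfc_def real_spectrum_def[symmetric]
    by (intro the_equality) (auto intro: LIMSEQ_unique[OF _ S] simp: q)
  with S show ?thesis by simp
qed

context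
  fixes T :: "'h::complex_hilbert_space \<Rightarrow>\<^sub>L 'h" and a b :: real
  assumes T: "hermitian T" and sp: "real_spectrum T \<subseteq> {a..b}"
begin

lemma cfc_approx:
  assumes "continuous_on {a..b} f"
  obtains q where "uniform_limit (real_spectrum T) (\<lambda>n. poly (q n)) f sequentially"
    "(\<lambda>n. op_poly (q n) T) \<longlonglongrightarrow> cfc f T"
proof -
  obtain q where "uniform_limit {a..b} (\<lambda>n. poly (q n)) f sequentially"
    using weierstrass_uniform_limit[OF assms] by blast
  then have "uniform_limit (real_spectrum T) (\<lambda>n. poly (q n)) f sequentially"
    using sp by (rule uniform_limit_on_subset)
  with cfc_tendsto[OF T this] show thesis by (rule that[rotated])
qed

lemma cfc_poly: "cfc (poly q) T = op_poly q T"
  by (rule LIMSEQ_unique[OF cfc_tendsto[OF T, of "\<lambda>_. q"]]) (auto intro: uniform_limit_const)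

lemma cfc_const: "cfc (\<lambda>_. c) T = c *\<^sub>R id_blinfun"
  using cfc_poly[of "[:c:]"] cfc_cong[of T "\<lambda>_. c" "poly [:c:]"] by (simp add: op_poly_const)

lemma cfc_ident: "cfc (\<lambda>t. t) T = T"
  using cfc_poly[of "[:0, 1:]"] cfc_cong[of T "\<lambda>t. t" "poly [:0, 1:]"] by simp

lemma cfc_add:
  assumes "continuous_on {a..b} f" "continuous_on {a..b} g"
  shows "cfc (\<lambda>t. f t + g t) T = cfc f T + cfc g T"
proof -
  obtain p where p: "uniform_limit (real_spectrum T) (\<lambda>n. poly (p n)) f sequentially"
    "(\<lambda>n. op_poly (p n) T) \<longlonglongrightarrow> cfc f T" using cfc_approx[OF assms(1)] by blast
  obtain q where q: "uniform_limit (real_spectrum T) (\<lambda>n. poly (q n)) g sequentially"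
    "(\<lambda>n. op_poly (q n) T) \<longlonglongrightarrow> cfc g T" using cfc_approx[OF assms(2)] by blast
  have "(\<lambda>n. op_poly (p n) T + op_poly (q n) T) \<longlonglongrightarrow> cfc f T + cfc g T"
    by (rule tendsto_add[OF p(2) q(2)])
  moreover have "(\<lambda>n. op_poly (p n + q n) T) \<longlonglongrightarrow> cfc (\<lambda>t. f t + g t) T"
  proof (rule cfc_tendsto[OF T])
    have eq: "(\<lambda>n. poly (p n + q n)) = (\<lambda>n t. poly (p n) t + poly (q n) t)" by (simp add: fun_eq_iff)
    show "uniform_limit (real_spectrum T) (\<lambda>n. poly (p n + q n)) (\<lambda>t. f t + g t) sequentially"
      unfolding eq by (rule uniform_limit_add[OF p(1) q(1)])
  qed
  ultimately show ?thesis unfolding op_poly_add by (rule LIMSEQ_unique[symmetric])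
qed

lemma cfc_mult:
  assumes f: "continuous_on {a..b} f" and g: "continuous_on {a..b} g"
  shows "cfc (\<lambda>t. f t * g t) T = cfc f T o\<^sub>L cfc g T"
proof -
  obtain p where p: "uniform_limit (real_spectrum T) (\<lambda>n. poly (p n)) f sequentially"
    "(\<lambda>n. op_poly (p n) T) \<longlonglongrightarrow> cfc f T" using cfc_approx[OF f] by blast
  obtain q where q: "uniform_limit (real_spectrum T) (\<lambda>n. poly (q n)) g sequentially"
    "(\<lambda>n. op_poly (q n) T) \<longlonglongrightarrow> cfc g T" using cfc_approx[OF g] by blast
  have bdd: "bounded (h ` real_spectrum T)" if "continuous_on {a..b} h" for h :: "real \<Rightarrow> real"
    by (rule bounded_subset[OF compact_imp_bounded[OF compact_continuous_image[OF that compact_Icc]]])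
      (use sp in blast)
  have "(\<lambda>n. op_poly (p n * q n) T) \<longlonglongrightarrow> cfc (\<lambda>t. f t * g t) T"
  proof (rule cfc_tendsto[OF T])
    have eq: "(\<lambda>n. poly (p n * q n)) = (\<lambda>n t. poly (p n) t * poly (q n) t)" by (simp add: fun_eq_iff)
    show "uniform_limit (real_spectrum T) (\<lambda>n. poly (p n * q n)) (\<lambda>t. f t * g t) sequentially"
      unfolding eq by (rule uniform_lim_mult[OF p(1) q(1) bdd[OF f] bdd[OF g]])
  qed
  moreover have "(\<lambda>n. op_poly (p n) T o\<^sub>L op_poly (q n) T) \<longlonglongrightarrow> (cfc f T o\<^sub>L cfc g T)"
    by (rule bounded_bilinear.tendsto[OF bounded_bilinear_blinfun_compose p(2) q(2)])
  ultimately show ?thesis unfolding op_poly_mult by (rule LIMSEQ_unique)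
qed

lemma cfc_cmult:
  assumes "continuous_on {a..b} f"
  shows "cfc (\<lambda>t. c * f t) T = c *\<^sub>R cfc f T"
  using cfc_mult[OF continuous_on_const assms, of c] by (auto simp: cfc_const intro!: blinfun_eqI)
    (simp add: blinfun.bilinear_simps)

lemma cfc_diff:
  assumes "continuous_on {a..b} f" "continuous_on {a..b} g"
  shows "cfc (\<lambda>t. f t - g t) T = cfc f T - cfc g T"
  using cfc_add[OF assms(1) continuous_on_mult_left[OF assms(2), of "- 1"]]
    cfc_cmult[OF assms(2), of "- 1"] by simp

lemma cfc_commutant:
  assumes "continuous_on {a..b} f" "A \<subseteq> bounded_ops" "T \<in> commutant A"
  shows "cfc f T \<in> commutant A"
proof -
  obtain q where "(\<lambda>n. op_poly (q n) T) \<longlonglongrightarrow> cfc f T" using cfc_approx[OF assms(1)] by blast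
  then show ?thesis by (rule commutant_closed[rotated]) (rule op_poly_commutant[OF assms(2,3)])
qed

lemma cfc_bounded_ops: "continuous_on {a..b} f \<Longrightarrow> cfc f T \<in> bounded_ops"
  using cfc_commutant[of f "{}"] T by (simp add: commutant_def hermitian_bounded_ops)

lemma cfc_commute:
  assumes "continuous_on {a..b} f" "A \<in> bounded_ops" "T o\<^sub>L A = A o\<^sub>L T"
  shows "cfc f T o\<^sub>L A = A o\<^sub>L cfc f T"
  using cfc_commutant[OF assms(1), of "{A}"] assms(2,3) T
  by (simp add: commutant_def hermitian_bounded_ops)

lemma hermitian_cfc:
  assumes "continuous_on {a..b} f"
  shows "hermitian (cfc f T)"
proof -
  obtain q where q: "(\<lambda>n. op_poly (q n) T) \<longlonglongrightarrow> cfc f T" using cfc_approx[OF assms] by blast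
  have "inner (blinfun_apply (cfc f T) x) y = inner x (blinfun_apply (cfc f T) y)" for x y
  proof (rule LIMSEQ_unique)
    show "(\<lambda>n. inner (blinfun_apply (op_poly (q n) T) x) y) \<longlonglongrightarrow> inner (blinfun_apply (cfc f T) x) y"
      by (intro tendsto_inner blinfun.tendsto q tendsto_const)
    show "(\<lambda>n. inner (blinfun_apply (op_poly (q n) T) x) y) \<longlonglongrightarrow> inner x (blinfun_apply (cfc f T) y)"
      unfolding hermitianD[OF hermitian_op_poly[OF T]]
      by (intro tendsto_inner blinfun.tendsto q tendsto_const)
  qed
  with cfc_bounded_ops[OF assms] show ?thesis by (simp add: hermitian_def)
qed

lemma norm_cfc_le:
  assumes f: "continuous_on {a..b} f" and c: "0 \<le> c" "\<And>t. t \<in> real_spectrum T \<Longrightarrow> \<bar>f t\<bar> \<le> c"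
  shows "norm (cfc f T) \<le> c"
proof (rule field_le_epsilon)
  fix e :: real assume e: "0 < e"
  obtain q where q: "uniform_limit (real_spectrum T) (\<lambda>n. poly (q n)) f sequentially"
    "(\<lambda>n. op_poly (q n) T) \<longlonglongrightarrow> cfc f T" using cfc_approx[OF f] by blast
  have "\<forall>\<^sub>F n in sequentially. norm (op_poly (q n) T) \<le> c + e"
    using uniform_limitD[OF q(1) e]
  proof eventually_elim
    case (elim n)
    show ?case
    proof (rule norm_op_poly_le[OF T])
      fix t assume "t \<in> real_spectrum T"
      then show "\<bar>poly (q n) t\<bar> \<le> c + e" using elim c(2)[of t] by (auto simp: dist_real_def)
    qed (use c e in simp)
  qed
  then show "norm (cfc f T) \<le> c + e"
    by (intro tendsto_upperbound[OF tendsto_norm[OF q(2)]]) auto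
qed

lemma abs_le_norm_cfc:
  assumes f: "continuous_on {a..b} f" and t: "t \<in> real_spectrum T"
  shows "\<bar>f t\<bar> \<le> norm (cfc f T)"
proof -
  obtain q where q: "uniform_limit (real_spectrum T) (\<lambda>n. poly (q n)) f sequentially"
    "(\<lambda>n. op_poly (q n) T) \<longlonglongrightarrow> cfc f T" using cfc_approx[OF f] by blast
  have "(\<lambda>n. poly (q n) t) \<longlonglongrightarrow> f t" using tendsto_uniform_limitI[OF q(1) t] .
  then have "(\<lambda>n. \<bar>poly (q n) t\<bar>) \<longlonglongrightarrow> \<bar>f t\<bar>" by (rule tendsto_rabs)
  then show ?thesis
    by (rule LIMSEQ_le[OF _ tendsto_norm[OF q(2)]]) (auto intro: abs_poly_le_norm_op_poly[OF T t])
qed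

lemma cfc_nonneg:
  assumes f: "continuous_on {a..b} f" "\<And>t. t \<in> {a..b} \<Longrightarrow> 0 \<le> f t"
  shows "0 \<le> inner x (blinfun_apply (cfc f T) x)"
proof -
  let ?H = "cfc (\<lambda>t. sqrt (f t)) T"
  have c: "continuous_on {a..b} (\<lambda>t. sqrt (f t))" by (intro continuous_intros f)
  have "cfc f T = cfc (\<lambda>t. sqrt (f t) * sqrt (f t)) T"
    by (rule cfc_cong) (use f(2) sp in auto)
  also have "\<dots> = ?H o\<^sub>L ?H" by (rule cfc_mult[OF c c])
  finally have "inner x (blinfun_apply (cfc f T) x) = inner (blinfun_apply ?H x) (blinfun_apply ?H x)"
    using hermitianD[OF hermitian_cfc[OF c]] by simp
  then show ?thesis by simp
qed

lemma real_spectrum_cfc: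
  assumes f: "continuous_on {a..b} f" "f ` {a..b} \<subseteq> {c..d}"
  shows "real_spectrum (cfc f T) \<subseteq> {c..d}"
proof (rule real_spectrum_bounds[OF hermitian_cfc[OF f(1)]])
  fix x
  have "0 \<le> inner x (blinfun_apply (cfc (\<lambda>t. f t - c) T) x)" "0 \<le> inner x (blinfun_apply (cfc (\<lambda>t. d - f t) T) x)"
    using f by (auto intro!: cfc_nonneg continuous_intros)
  then show "c * inner x x \<le> inner x (blinfun_apply (cfc f T) x)"
    "inner x (blinfun_apply (cfc f T) x) \<le> d * inner x x"
    using f(1) by (simp_all add: cfc_diff cfc_const blinfun.bilinear_simps inner_simps)
qed

lemma op_poly_cfc:
  assumes f: "continuous_on {a..b} f"
  shows "op_poly q (cfc f T) = cfc (\<lambda>t. poly q (f t)) T"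
proof (induction q)
  case 0
  then show ?case by (simp add: cfc_const)
next
  case (pCons c q)
  have "continuous_on {a..b} (\<lambda>t. poly q (f t))" by (intro continuous_intros f)
  then show ?case
    using f by (simp add: pCons cfc_add cfc_mult cfc_const continuous_intros)
qed

lemma cfc_compose:
  assumes f: "continuous_on {a..b} f" "f ` {a..b} \<subseteq> {c..d}" and g: "continuous_on {c..d} g"
  shows "cfc g (cfc f T) = cfc (\<lambda>t. g (f t)) T"
proof -
  have gf: "continuous_on {a..b} (\<lambda>t. g (f t))"
    by (rule continuous_on_compose2[OF g f])
  obtain q where q: "uniform_limit {c..d} (\<lambda>n. poly (q n)) g sequentially"
    using weierstrass_uniform_limit[OF g] by blast
  have "(\<lambda>n. op_poly (q n) (cfc f T)) \<longlonglongrightarrow> cfc g (cfc f T)"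
    by (rule cfc_tendsto[OF hermitian_cfc[OF f(1)]])
      (rule uniform_limit_on_subset[OF q real_spectrum_cfc[OF f]])
  moreover have "(\<lambda>n. op_poly (q n) (cfc f T)) \<longlonglongrightarrow> cfc (\<lambda>t. g (f t)) T"
  proof (rule LIMSEQ_I)
    fix e :: real assume e: "0 < e"
    then have "0 < e / 2" by simp
    from uniform_limitD[OF q this] obtain N
      where N: "\<And>n t. N \<le> n \<Longrightarrow> t \<in> {c..d} \<Longrightarrow> dist (poly (q n) t) (g t) < e / 2"
      unfolding eventually_sequentially by blast
    have "norm (op_poly (q n) (cfc f T) - cfc (\<lambda>t. g (f t)) T) < e" if "N \<le> n" for n
    proof -
      have c: "continuous_on {a..b} (\<lambda>t. poly (q n) (f t))" by (intro continuous_intros f)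
      have "norm (cfc (\<lambda>t. poly (q n) (f t) - g (f t)) T) \<le> e / 2"
      proof (rule norm_cfc_le)
        fix t assume "t \<in> real_spectrum T"
        then have "f t \<in> {c..d}" using sp f(2) by blast
        then show "\<bar>poly (q n) (f t) - g (f t)\<bar> \<le> e / 2"
          using N[OF that] by (force simp: dist_real_def intro: less_imp_le)
      qed (use e in \<open>auto intro!: continuous_on_diff c gf\<close>)
      then show ?thesis using e by (simp add: op_poly_cfc[OF f(1)] cfc_diff[OF c gf])
    qed
    then show "\<exists>N. \<forall>n\<ge>N. norm (op_poly (q n) (cfc f T) - cfc (\<lambda>t. g (f t)) T) < e" by blast
  qed
  ultimately show ?thesis by (rule LIMSEQ_unique)
qed

end

section \<open>The trace of a finite factor\<close>

definition nonneg_op :: "('h::complex_hilbert_space \<Rightarrow>\<^sub>L 'h) \<Rightarrow> bool" where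
  "nonneg_op T \<longleftrightarrow> hermitian T \<and> (\<forall>x. 0 \<le> inner x (blinfun_apply T x))"

lemma nonneg_op_imp_positive_op:
  assumes "nonneg_op T"
  shows "positive_op T"
proof -
  have T: "hermitian T" "T \<in> bounded_ops" and pos: "\<And>x. 0 \<le> inner x (blinfun_apply T x)"
    using assms by (auto simp: nonneg_op_def hermitian_bounded_ops)
  have "inner x (\<i> *\<^sub>C blinfun_apply T x) = 0" for x
  proof -
    have "inner x (\<i> *\<^sub>C blinfun_apply T x) = inner (blinfun_apply T x) (\<i> *\<^sub>C x)"
      using hermitianD[OF T(1), of x "\<i> *\<^sub>C x"] by (simp add: bounded_ops_scaleC[OF T(2)])
    also have "\<dots> = inner (cnj \<i> *\<^sub>C blinfun_apply T x) x"
      by (simp add: inner_scaleC_left)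
    also have "cnj \<i> *\<^sub>C blinfun_apply T x = - (\<i> *\<^sub>C blinfun_apply T x)"
      using scaleC_scaleC[of "- 1" \<i> "blinfun_apply T x"] by (simp add: scaleC_minus_one)
    finally show ?thesis by (simp add: inner_commute)
  qed
  then show ?thesis
    using T pos by (simp add: positive_op_def cinner_eq_Complex complex_nonneg_Reals_iff)
qed

lemma nonneg_op_adj_compose:
  assumes "T \<in> bounded_ops"
  shows "nonneg_op (adj T o\<^sub>L T)"
  using assms by (simp add: nonneg_op_def inner_adj_right)

lemma adj_compose_eq_0:
  assumes "T \<in> bounded_ops" "adj T o\<^sub>L T = 0"
  shows "T = 0"
proof (rule blinfun_eqI)
  fix x
  have "inner (blinfun_apply T x) (blinfun_apply T x) = inner x (blinfun_apply (adj T o\<^sub>L T) x)"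
    using assms(1) by (simp add: inner_adj_right)
  then show "blinfun_apply T x = blinfun_apply 0 x" using assms(2) by simp
qed

lemma nonneg_op_cfc:
  assumes "hermitian T" "real_spectrum T \<subseteq> {a..b}" "continuous_on {a..b} f" "\<And>t. t \<in> {a..b} \<Longrightarrow> 0 \<le> f t"
  shows "nonneg_op (cfc f T)"
  unfolding nonneg_op_def using hermitian_cfc[OF assms(1-3)] cfc_nonneg[OF assms] by blast

lemma continuous_on_powr_const:
  assumes "0 < s"
  shows "continuous_on {0..b} (\<lambda>t::real. t powr s)"
  by (rule continuous_on_powr') (use assms in \<open>auto intro: continuous_intros\<close>)

lemma cfc_powr_1:
  assumes "hermitian T" "real_spectrum T \<subseteq> {0..b}"
  shows "cfc (\<lambda>t. t powr 1) T = T"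
proof -
  have "cfc (\<lambda>t. t powr 1) T = cfc (\<lambda>t. t) T"
    by (rule cfc_cong) (use assms(2) in auto)
  then show ?thesis using cfc_ident[OF assms] by simp
qed

lemma scaleR_four: "(4::real) *\<^sub>R x = x + x + x + (x :: 'a::real_vector)"
proof -
  have "(4::real) *\<^sub>R x = (2 + 2) *\<^sub>R x" by simp
  then show ?thesis by (simp only: scaleR_add_left scaleR_2 add.assoc)
qed

context
  fixes N :: "('h::complex_hilbert_space \<Rightarrow>\<^sub>L 'h) set" and \<tau> :: "('h \<Rightarrow>\<^sub>L 'h) \<Rightarrow> complex"
  assumes ff: "finite_factor N \<tau>"
begin

lemma N_eq_bicommutant: "N = commutant (commutant N)"
  and N_bounded_ops: "A \<in> N \<Longrightarrow> A \<in> bounded_ops"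
  and N_adj: "A \<in> N \<Longrightarrow> adj A \<in> N"
  using ff by (auto simp: finite_factor_def factor_def von_neumann_algebra_def)

lemma commutant_N_bounded_ops: "commutant N \<subseteq> bounded_ops"
  by (auto simp: commutant_def)

lemma N_closure:
  "id_blinfun \<in> N" "0 \<in> N"
  "A \<in> N \<Longrightarrow> B \<in> N \<Longrightarrow> A + B \<in> N" "A \<in> N \<Longrightarrow> B \<in> N \<Longrightarrow> A - B \<in> N"
  "A \<in> N \<Longrightarrow> B \<in> N \<Longrightarrow> A o\<^sub>L B \<in> N" "A \<in> N \<Longrightarrow> r *\<^sub>R A \<in> N" "A \<in> N \<Longrightarrow> - A \<in> N"
  using commutant_closure[OF commutant_N_bounded_ops] N_eq_bicommutant by simp_all

lemmas N_simps = N_closure N_adj N_bounded_ops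

lemma N_cfc:
  assumes "hermitian T" "real_spectrum T \<subseteq> {a..b}" "continuous_on {a..b} f" "T \<in> N"
  shows "cfc f T \<in> N"
  using cfc_commutant[OF assms(1-3) commutant_N_bounded_ops] assms(4) N_eq_bicommutant by simp

lemma trace_add: "A \<in> N \<Longrightarrow> B \<in> N \<Longrightarrow> Re (\<tau> (A + B)) = Re (\<tau> A) + Re (\<tau> B)"
  and trace_id: "Re (\<tau> id_blinfun) = 1"
  and trace_commute: "A \<in> N \<Longrightarrow> B \<in> N \<Longrightarrow> \<tau> (A o\<^sub>L B) = \<tau> (B o\<^sub>L A)"
  using ff by (auto simp: finite_factor_def tracial_state_def)

lemma trace_scaleR:
  assumes "A \<in> N"
  shows "Re (\<tau> (r *\<^sub>R A)) = r * Re (\<tau> A)"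
proof -
  have "r *\<^sub>R A = scalar_op (complex_of_real r) o\<^sub>L A"
    by (rule blinfun_eqI) (simp add: scalar_op_of_real blinfun.bilinear_simps)
  then show ?thesis using ff assms by (simp add: finite_factor_def tracial_state_def)
qed

lemma trace_diff:
  assumes "A \<in> N" "B \<in> N"
  shows "Re (\<tau> (A - B)) = Re (\<tau> A) - Re (\<tau> B)"
  using trace_add[OF assms(1), of "(- 1) *\<^sub>R B"] trace_scaleR[OF assms(2), of "- 1"] assms
  by (simp add: N_closure)

lemmas trace_simps = trace_add trace_diff trace_scaleR trace_id

lemma trace_nonneg:
  assumes "A \<in> N" "nonneg_op A"
  shows "0 \<le> Re (\<tau> A)"
  using ff assms(1) nonneg_op_imp_positive_op[OF assms(2)]
  by (simp add: finite_factor_def tracial_state_def complex_nonneg_Reals_iff)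

lemma trace_eq_0:
  assumes "A \<in> N" "nonneg_op A" "Re (\<tau> A) = 0"
  shows "A = 0"
proof -
  note pos = nonneg_op_imp_positive_op[OF assms(2)]
  have "\<tau> A \<in> \<real>\<^sub>\<ge>\<^sub>0" using ff assms(1) pos
    by (simp add: finite_factor_def tracial_state_def)
  then have "\<tau> A = 0" using assms(3) by (simp add: complex_nonneg_Reals_iff complex_eq_iff)
  then show ?thesis using ff assms(1) pos
    by (simp add: finite_factor_def faithful_functional_def)
qed

lemma trace_compose_nonneg:
  assumes H: "H \<in> N" "nonneg_op H" and Z: "Z \<in> N"
  shows "0 \<le> Re (\<tau> (H o\<^sub>L (adj Z o\<^sub>L Z)))"
proof -
  have "H o\<^sub>L (adj Z o\<^sub>L Z) = (H o\<^sub>L adj Z) o\<^sub>L Z" by (rule blinfun_eqI) simp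
  then have "\<tau> (H o\<^sub>L (adj Z o\<^sub>L Z)) = \<tau> (Z o\<^sub>L (H o\<^sub>L adj Z))"
    using trace_commute[of "H o\<^sub>L adj Z" Z] H Z by (simp add: N_simps)
  moreover have "nonneg_op (Z o\<^sub>L (H o\<^sub>L adj Z))"
  proof -
    have Zl: "inner (blinfun_apply Z u) v = inner u (blinfun_apply (adj Z) v)"
      and Zr: "inner u (blinfun_apply Z v) = inner (blinfun_apply (adj Z) u) v" for u v
      using Z by (simp_all add: inner_adj_left inner_adj_right N_bounded_ops)
    have "hermitian H" "\<And>x. 0 \<le> inner x (blinfun_apply H x)" using H by (auto simp: nonneg_op_def)
    then show ?thesis using H Z
      by (simp add: nonneg_op_def hermitian_def[of "Z o\<^sub>L _"] N_simps Zl Zr hermitianD)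
  qed
  ultimately show ?thesis using trace_nonneg H Z by (simp add: N_simps)
qed

lemma cfc_eq_0_on_spectrum:
  assumes T: "T \<in> N" "hermitian T" "real_spectrum T \<subseteq> {a..b}"
    and f: "continuous_on {a..b} f" "\<And>t. t \<in> {a..b} \<Longrightarrow> 0 \<le> f t" "Re (\<tau> (cfc f T)) = 0"
    and t: "t \<in> real_spectrum T"
  shows "f t = 0"
proof -
  have "cfc f T = 0"
    by (rule trace_eq_0[OF N_cfc[OF T(2,3) f(1) T(1)] nonneg_op_cfc[OF T(2,3) f(1,2)] f(3)])
  then show ?thesis using abs_le_norm_cfc[OF T(2,3) f(1) t] by simp
qed

lemma lp_norm_powr:
  assumes p: "0 < p" and A: "A \<in> N" and sp: "real_spectrum (adj A o\<^sub>L A) \<subseteq> {0..b}"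
  shows "lp_norm \<tau> p A powr p = Re (\<tau> (cfc (\<lambda>t. t powr (p / 2)) (adj A o\<^sub>L A)))"
proof -
  let ?T = "adj A o\<^sub>L A"
  have T: "hermitian ?T" "?T \<in> N" using A by (auto simp: N_simps)
  have c: "continuous_on {0..b} (\<lambda>t. t powr (p / 2))"
    using p by (intro continuous_on_powr_const) simp
  have "cfc (\<lambda>t. t powr p) (abs_op A) = cfc (\<lambda>t. sqrt t powr p) ?T"
    unfolding abs_op_def
    by (rule cfc_compose[OF T(1) sp _ _ continuous_on_powr_const[OF p, of "sqrt b"]])
      (auto intro: continuous_intros)
  also have "\<dots> = cfc (\<lambda>t. t powr (p / 2)) ?T"
  proof (rule cfc_cong)
    fix t assume "t \<in> real_spectrum ?T"
    then have "0 \<le> t" using sp by auto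
    then show "sqrt t powr p = t powr (p / 2)" by (simp add: powr_powr flip: powr_half_sqrt)
  qed
  finally have "lp_norm \<tau> p A = Re (\<tau> (cfc (\<lambda>t. t powr (p / 2)) ?T)) powr (1 / p)"
    by (simp add: lp_norm_def)
  moreover have "0 \<le> Re (\<tau> (cfc (\<lambda>t. t powr (p / 2)) ?T))"
    by (rule trace_nonneg[OF N_cfc[OF T(1) sp c T(2)] nonneg_op_cfc[OF T(1) sp c]]) simp
  ultimately show ?thesis using p by (simp add: powr_powr)
qed

section \<open>Distances between unitaries\<close>

lemma unitary_groupD:
  assumes "U \<in> unitary_group N"
  shows "U \<in> N" "U \<in> bounded_ops" "adj U \<in> N" "adj U \<in> bounded_ops"
    "blinfun_apply (adj U) (blinfun_apply U x) = x" "blinfun_apply U (blinfun_apply (adj U) x) = x"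
  using assms unfolding unitary_group_def
  by (auto simp: N_simps dest!: arg_cong[of _ _ "\<lambda>A. blinfun_apply A x"])

lemma unitary_group_closure:
  "id_blinfun \<in> unitary_group N"
  "U \<in> unitary_group N \<Longrightarrow> - U \<in> unitary_group N"
  "U \<in> unitary_group N \<Longrightarrow> adj U \<in> unitary_group N"
  unfolding unitary_group_def by (auto simp: N_simps blinfun_eqI bounded_bilinear.minus_left[OF bounded_bilinear_blinfun_compose]
      bounded_bilinear.minus_right[OF bounded_bilinear_blinfun_compose])

lemma real_spectrum_unitary_diff:
  assumes U: "U \<in> unitary_group N" and V: "V \<in> unitary_group N"
  shows "real_spectrum (adj (U - V) o\<^sub>L (U - V)) \<subseteq> {0..4}"
proof (rule real_spectrum_bounds)
  note UV = unitary_groupD[OF U] unitary_groupD[OF V]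
  show "hermitian (adj (U - V) o\<^sub>L (U - V))" using UV by (simp del: adj_simps)
  fix x
  show "0 * inner x x \<le> inner x (blinfun_apply (adj (U - V) o\<^sub>L (U - V)) x)"
    using nonneg_op_adj_compose[of "U - V"] UV by (simp add: nonneg_op_def del: adj_simps)
  have "0 \<le> inner x (blinfun_apply (adj (U + V) o\<^sub>L (U + V)) x)"
    using nonneg_op_adj_compose[of "U + V"] UV by (simp add: nonneg_op_def del: adj_simps)
  also have "blinfun_apply (adj (U + V) o\<^sub>L (U + V)) x = 4 *\<^sub>R x - blinfun_apply (adj (U - V) o\<^sub>L (U - V)) x"
    using UV by (simp add: blinfun.bilinear_simps scaleR_four)
  finally show "inner x (blinfun_apply (adj (U - V) o\<^sub>L (U - V)) x) \<le> 4 * inner x x"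
    by (simp add: inner_simps)
qed

lemma cfc_4_minus:
  assumes T: "hermitian T" "real_spectrum T \<subseteq> {0..4}"
  shows "cfc (\<lambda>t. 4 - t) T = 4 *\<^sub>R id_blinfun - T"
  using cfc_diff[OF T continuous_on_const continuous_on_id, of 4] cfc_const[OF T] cfc_ident[OF T] by simp

lemma cfc_4_diff:
  assumes T: "hermitian T" "real_spectrum T \<subseteq> {0..4}" and g: "continuous_on {0..4} g"
  shows "cfc g (4 *\<^sub>R id_blinfun - T) = cfc (\<lambda>t. g (4 - t)) T"
proof -
  have c: "continuous_on {0..4::real} (\<lambda>t. 4 - t)" by (intro continuous_intros)
  show ?thesis using cfc_compose[OF T c _ g] cfc_4_minus[OF T] by auto
qed

lemma powr_add_powr_complement:
  fixes s t :: real
  assumes "0 < t" "t < 4" "0 < s"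
  shows "s < 1 \<Longrightarrow> 4 powr s < t powr s + (4 - t) powr s"
    and "1 < s \<Longrightarrow> t powr s + (4 - t) powr s < 4 powr s"
proof -
  have eq: "x powr s = 4 powr s * (x / 4) powr s" if "0 < x" for x :: real
    using that by (simp add: powr_divide)
  have sum: "t powr s + (4 - t) powr s = 4 powr s * ((t / 4) powr s + ((4 - t) / 4) powr s)"
    using eq[of t] eq[of "4 - t"] assms by (simp add: distrib_left)
  have one: "t / 4 + (4 - t) / 4 = 1" by (simp add: field_simps)
  show "4 powr s < t powr s + (4 - t) powr s" if "s < 1"
  proof -
    have "t / 4 < (t / 4) powr s" "(4 - t) / 4 < ((4 - t) / 4) powr s"
      using powr_less_mono'[of "t / 4" s 1] powr_less_mono'[of "(4 - t) / 4" s 1] that assms by auto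
    then have "1 < (t / 4) powr s + ((4 - t) / 4) powr s" using one by linarith
    then show ?thesis unfolding sum by simp
  qed
  show "t powr s + (4 - t) powr s < 4 powr s" if "1 < s"
  proof -
    have "(t / 4) powr s < t / 4" "((4 - t) / 4) powr s < (4 - t) / 4"
      using powr_less_mono'[of "t / 4" 1 s] powr_less_mono'[of "(4 - t) / 4" 1 s] that assms by auto
    then have "(t / 4) powr s + ((4 - t) / 4) powr s < 1" using one by linarith
    then show ?thesis unfolding sum by simp
  qed
qed

lemma selfadjoint_iff_spectrum:
  assumes U: "U \<in> unitary_group N"
  shows "adj U = U \<longleftrightarrow> real_spectrum (adj (U - id_blinfun) o\<^sub>L (U - id_blinfun)) \<subseteq> {0, 4}"
proof -
  note U' = unitary_groupD[OF U]
  define T where "T = adj (U - id_blinfun) o\<^sub>L (U - id_blinfun)"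
  have T: "hermitian T" "real_spectrum T \<subseteq> {0..4}"
    using U' real_spectrum_unitary_diff[OF U unitary_group_closure(1)] by (auto simp: T_def simp del: adj_simps)
  have c: "continuous_on {0..4::real} (\<lambda>t. t)" "continuous_on {0..4::real} (\<lambda>t. 4 - t)"
    by (intro continuous_intros)+
  have "cfc (\<lambda>t. t * (4 - t)) T = T o\<^sub>L (4 *\<^sub>R id_blinfun - T)"
    unfolding cfc_mult[OF T c] cfc_4_minus[OF T] cfc_ident[OF T] ..
  also have "\<dots> = adj (U - adj U) o\<^sub>L (U - adj U)"
    by (rule blinfun_eqI) (use U' in \<open>simp add: T_def blinfun.bilinear_simps scaleR_four algebra_simps\<close>)
  finally have eq: "cfc (\<lambda>t. t * (4 - t)) T = adj (U - adj U) o\<^sub>L (U - adj U)" .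
  have cc: "continuous_on {0..4::real} (\<lambda>t. t * (4 - t))" by (intro continuous_intros)
  show ?thesis unfolding T_def[symmetric]
  proof
    assume "adj U = U"
    then have "cfc (\<lambda>t. t * (4 - t)) T = 0" using eq by simp
    then show "real_spectrum T \<subseteq> {0, 4}"
      using abs_le_norm_cfc[OF T cc] by auto
  next
    assume "real_spectrum T \<subseteq> {0, 4}"
    then have "norm (cfc (\<lambda>t. t * (4 - t)) T) \<le> 0"
      by (intro norm_cfc_le[OF T cc]) auto
    then have "adj (U - adj U) o\<^sub>L (U - adj U) = 0" using eq by simp
    then have "U - adj U = 0" by (rule adj_compose_eq_0[rotated]) (use U' in simp)
    then show "adj U = U" by simp
  qed
qed

lemma selfadjoint_iff_trace_powr:
  assumes U: "U \<in> unitary_group N" and s: "0 < s" "s \<noteq> 1"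
  shows "adj U = U \<longleftrightarrow>
    Re (\<tau> (cfc (\<lambda>t. t powr s) (adj (U - id_blinfun) o\<^sub>L (U - id_blinfun)))) +
    Re (\<tau> (cfc (\<lambda>t. t powr s) (adj (U - - id_blinfun) o\<^sub>L (U - - id_blinfun)))) = 4 powr s"
proof -
  note U' = unitary_groupD[OF U]
  define T where "T = adj (U - id_blinfun) o\<^sub>L (U - id_blinfun)"
  have T: "T \<in> N" "hermitian T" "real_spectrum T \<subseteq> {0..4}"
    using U' real_spectrum_unitary_diff[OF U unitary_group_closure(1)] by (auto simp: T_def N_simps simp del: adj_simps)
  have c: "continuous_on {0..4::real} (\<lambda>t. t powr s)"
    using s by (rule_tac continuous_on_powr_const) simp
  have c': "continuous_on {0..4::real} (\<lambda>t. (4 - t) powr s)"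
    by (rule continuous_on_compose2[OF c]) (auto intro: continuous_intros)
  define h where "h t = t powr s + (4 - t) powr s - 4 powr s" for t :: real
  have ch: "continuous_on {0..4} h" unfolding h_def by (intro continuous_intros c c')
  have "adj (U - - id_blinfun) o\<^sub>L (U - - id_blinfun) = 4 *\<^sub>R id_blinfun - T"
    by (rule blinfun_eqI) (use U' in \<open>simp add: T_def blinfun.bilinear_simps scaleR_four algebra_simps\<close>)
  then have T4: "cfc (\<lambda>t. t powr s) (adj (U - - id_blinfun) o\<^sub>L (U - - id_blinfun)) = cfc (\<lambda>t. (4 - t) powr s) T"
    using cfc_4_diff[OF T(2,3) c] by simp
  have "cfc h T = cfc (\<lambda>t. t powr s) T + cfc (\<lambda>t. (4 - t) powr s) T - (4 powr s) *\<^sub>R id_blinfun"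
    unfolding h_def
    using cfc_diff[OF T(2,3) continuous_on_add[OF c c'] continuous_on_const, of "4 powr s"]
      cfc_add[OF T(2,3) c c'] cfc_const[OF T(2,3)] by simp
  then have trh: "Re (\<tau> (cfc h T)) = Re (\<tau> (cfc (\<lambda>t. t powr s) T)) +
      Re (\<tau> (cfc (\<lambda>t. (4 - t) powr s) T)) - 4 powr s"
    using N_cfc[OF T(2,3) c T(1)] N_cfc[OF T(2,3) c' T(1)] by (simp add: trace_simps N_simps)
  have ends: "h 0 = 0" "h 4 = 0" by (simp_all add: h_def)
  have "real_spectrum T \<subseteq> {0, 4} \<longleftrightarrow> Re (\<tau> (cfc h T)) = 0"
  proof
    assume "real_spectrum T \<subseteq> {0, 4}"
    then have "norm (cfc h T) \<le> 0" using ends by (intro norm_cfc_le[OF T(2,3) ch]) auto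
    then show "Re (\<tau> (cfc h T)) = 0" using trace_scaleR[of id_blinfun 0] by (simp add: N_closure)
  next
    assume tr0: "Re (\<tau> (cfc h T)) = 0"
    have "t = 0 \<or> t = 4" if t: "t \<in> real_spectrum T" for t
    proof (rule ccontr)
      assume "\<not> ?thesis"
      then have t04: "0 < t" "t < 4" using T(3) t by fastforce+
      consider "s < 1" | "1 < s" using s(2) by linarith
      then have "h t = 0"
      proof cases
        case 1
        have "0 \<le> h u" if "u \<in> {0..4}" for u
          using powr_add_powr_complement(1)[of u s] that ends 1 s(1)
          by (cases "u = 0 \<or> u = 4") (auto simp: h_def)
        then show ?thesis by (rule cfc_eq_0_on_spectrum[OF T ch _ tr0 t])
      next
        case 2
        have "0 \<le> (- 1) * h u" if "u \<in> {0..4}" for u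
          using powr_add_powr_complement(2)[of u s] that ends 2 s(1)
          by (cases "u = 0 \<or> u = 4") (auto simp: h_def)
        moreover have "Re (\<tau> (cfc (\<lambda>u. (- 1) * h u) T)) = 0"
          unfolding cfc_cmult[OF T(2,3) ch] using trace_scaleR[OF N_cfc[OF T(2,3) ch T(1)], of "- 1"] tr0 by simp
        ultimately have "(- 1) * h t = 0"
          by (intro cfc_eq_0_on_spectrum[OF T continuous_on_mult_left[OF ch] _ _ t])
        then show ?thesis by simp
      qed
      then show False
        using powr_add_powr_complement[OF t04 s(1)] s(2) by (fastforce simp: h_def)
    qed
    then show "real_spectrum T \<subseteq> {0, 4}" by blast
  qed
  then show ?thesis
    unfolding selfadjoint_iff_spectrum[OF U] T4 T_def[symmetric] trh by simp
qed

lemma trace_powr_eq_4_iff: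
  assumes V: "V \<in> unitary_group N" and s: "0 < s"
  shows "Re (\<tau> (cfc (\<lambda>t. t powr s) (adj (V - id_blinfun) o\<^sub>L (V - id_blinfun)))) = 4 powr s \<longleftrightarrow>
    V = - id_blinfun"
proof -
  note V' = unitary_groupD[OF V]
  define T where "T = adj (V - id_blinfun) o\<^sub>L (V - id_blinfun)"
  have T: "T \<in> N" "hermitian T" "real_spectrum T \<subseteq> {0..4}"
    using V' real_spectrum_unitary_diff[OF V unitary_group_closure(1)] by (auto simp: T_def N_simps simp del: adj_simps)
  have c: "continuous_on {0..4::real} (\<lambda>t. t powr s)"
    using s by (rule continuous_on_powr_const)
  have c': "continuous_on {0..4::real} (\<lambda>t. 4 powr s - t powr s)"
    by (intro continuous_intros c)
  have tr: "Re (\<tau> (cfc (\<lambda>t. 4 powr s - t powr s) T)) = 4 powr s - Re (\<tau> (cfc (\<lambda>t. t powr s) T))"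
    using N_cfc[OF T(2,3) c T(1)]
    by (simp add: cfc_diff[OF T(2,3) continuous_on_const c] cfc_const[OF T(2,3)] trace_simps N_simps)
  have c4: "continuous_on {0..4::real} (\<lambda>t. 4 - t)" by (intro continuous_intros)
  have cfc4: "cfc (\<lambda>t. 4 - t) T = adj (V + id_blinfun) o\<^sub>L (V + id_blinfun)"
    unfolding cfc_4_minus[OF T(2,3)]
    by (rule blinfun_eqI) (use V' in \<open>simp add: T_def blinfun.bilinear_simps scaleR_four algebra_simps\<close>)
  have "real_spectrum T \<subseteq> {4} \<longleftrightarrow> V = - id_blinfun"
  proof
    assume "real_spectrum T \<subseteq> {4}"
    then have "norm (cfc (\<lambda>t. 4 - t) T) \<le> 0" by (intro norm_cfc_le[OF T(2,3) c4]) auto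
    then have "adj (V + id_blinfun) o\<^sub>L (V + id_blinfun) = 0" by (simp add: cfc4)
    then have "V + id_blinfun = 0" by (rule adj_compose_eq_0[rotated]) (use V' in simp)
    then show "V = - id_blinfun" by (simp add: eq_neg_iff_add_eq_0)
  next
    assume "V = - id_blinfun"
    then have "cfc (\<lambda>t. 4 - t) T = 0" unfolding cfc4 by simp
    then show "real_spectrum T \<subseteq> {4}" using abs_le_norm_cfc[OF T(2,3) c4] by auto
  qed
  moreover have "real_spectrum T \<subseteq> {4} \<longleftrightarrow> Re (\<tau> (cfc (\<lambda>t. 4 powr s - t powr s) T)) = 0"
  proof
    assume "real_spectrum T \<subseteq> {4}"
    then have "norm (cfc (\<lambda>t. 4 powr s - t powr s) T) \<le> 0"
      by (intro norm_cfc_le[OF T(2,3) c']) auto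
    then show "Re (\<tau> (cfc (\<lambda>t. 4 powr s - t powr s) T)) = 0"
      using trace_scaleR[of id_blinfun 0] by (simp add: N_closure)
  next
    assume tr0: "Re (\<tau> (cfc (\<lambda>t. 4 powr s - t powr s) T)) = 0"
    have "t = 4" if t: "t \<in> real_spectrum T" for t
    proof -
      have "4 powr s - t powr s = 0"
        by (rule cfc_eq_0_on_spectrum[OF T c' _ tr0 t]) (use s in \<open>auto intro: powr_mono2\<close>)
      moreover have "0 \<le> t" "t \<le> 4" using T(3) t by auto
      ultimately show "t = 4" using powr_less_mono2[of s t 4] s by (cases "t = 4") auto
    qed
    then show "real_spectrum T \<subseteq> {4}" by blast
  qed
  ultimately show ?thesis unfolding tr T_def[symmetric] by auto
qed

lemma nonneg_op_id_plus_symmetry: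
  assumes U: "U \<in> unitary_group N" and sa: "adj U = U"
  shows "nonneg_op (id_blinfun + U)"
proof -
  note U' = unitary_groupD[OF U, unfolded sa]
  let ?A = "id_blinfun + U"
  have A: "?A \<in> bounded_ops" "adj ?A = ?A" using U' sa by simp_all
  have "?A o\<^sub>L ?A = 2 *\<^sub>R ?A"
    by (rule blinfun_eqI) (use U' in \<open>simp add: blinfun.bilinear_simps scaleR_2\<close>)
  then have "inner x (blinfun_apply (adj ?A o\<^sub>L ?A) x) = 2 * inner x (blinfun_apply ?A x)" for x
    unfolding A(2) by (simp add: blinfun.bilinear_simps)
  then have "0 \<le> inner x (blinfun_apply ?A x)" for x
    using nonneg_op_adj_compose[OF A(1)] unfolding nonneg_op_def
    by (metis zero_le_mult_iff zero_less_numeral not_less)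
  with A show ?thesis unfolding nonneg_op_def hermitian_iff_adj by blast
qed

lemma selfadjoint_imp_L2_bound:
  assumes U: "U \<in> unitary_group N" and sa: "adj U = U" and W: "W \<in> unitary_group N"
  shows "\<bar>Re (\<tau> (adj (W - U) o\<^sub>L (W - U))) - Re (\<tau> (adj (id_blinfun - U) o\<^sub>L (id_blinfun - U)))\<bar>
    \<le> Re (\<tau> (adj (W - id_blinfun) o\<^sub>L (W - id_blinfun)))"
proof -
  note U' = unitary_groupD[OF U, unfolded sa] and W' = unitary_groupD[OF W]
  define D where "D = adj (W - id_blinfun) o\<^sub>L (W - id_blinfun)"
  have D: "D \<in> N" using W' by (simp add: D_def N_simps)
  have mem: "adj W o\<^sub>L U \<in> N" "U o\<^sub>L adj W \<in> N" "U o\<^sub>L W \<in> N" "U o\<^sub>L D \<in> N"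
    using U' W' D by (simp_all add: N_simps)
  have "0 \<le> Re (\<tau> ((id_blinfun + U) o\<^sub>L D))" "0 \<le> Re (\<tau> ((id_blinfun + - U) o\<^sub>L D))"
    unfolding D_def
    by (rule trace_compose_nonneg nonneg_op_id_plus_symmetry U unitary_group_closure(2)[OF U]
        | use sa U' W' in \<open>simp add: N_closure\<close>)+
  moreover have "(id_blinfun + U) o\<^sub>L D = D + (U o\<^sub>L D)" "(id_blinfun + - U) o\<^sub>L D = D - (U o\<^sub>L D)"
    by (auto intro!: blinfun_eqI simp: blinfun.bilinear_simps)
  ultimately have "\<bar>Re (\<tau> (U o\<^sub>L D))\<bar> \<le> Re (\<tau> D)"
    using D mem by (simp add: trace_simps abs_le_iff)
  moreover have "Re (\<tau> (adj (W - U) o\<^sub>L (W - U))) - Re (\<tau> (adj (id_blinfun - U) o\<^sub>L (id_blinfun - U))) = Re (\<tau> (U o\<^sub>L D))"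
  proof -
    have "adj (W - U) o\<^sub>L (W - U) = 2 *\<^sub>R id_blinfun - (adj W o\<^sub>L U) - (U o\<^sub>L W)"
      by (rule blinfun_eqI) (use U' W' sa in \<open>simp add: blinfun.bilinear_simps scaleR_2\<close>)
    moreover have "adj (id_blinfun - U) o\<^sub>L (id_blinfun - U) = 2 *\<^sub>R id_blinfun - 2 *\<^sub>R U"
      by (rule blinfun_eqI) (use U' sa in \<open>simp add: blinfun.bilinear_simps scaleR_2\<close>)
    moreover have "U o\<^sub>L D = 2 *\<^sub>R U - (U o\<^sub>L W) - (U o\<^sub>L adj W)"
      by (rule blinfun_eqI) (use W' in \<open>simp add: D_def blinfun.bilinear_simps scaleR_2\<close>)
    ultimately show ?thesis
      using mem U' W' trace_commute[of "adj W" U] by (simp add: trace_simps N_closure)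
  qed
  ultimately show ?thesis by (simp add: D_def)
qed

text \<open>
  The test unitary is \<open>W = \<surd>(1 - Q / 64) + P / 8\<close> with \<open>P = Y - Y*\<close> and \<open>Q = P*P\<close>: to first order
  it moves from \<open>I\<close> in the direction of the skew part of \<open>Y\<close>, and the bound for this \<open>W\<close>
  reads \<open>\<tau>(Q) / 8 \<le> \<tau>(Q) / 16\<close>.
\<close>

lemma L2_bound_imp_selfadjoint:
  assumes Y: "Y \<in> unitary_group N"
    and bound: "\<And>W. W \<in> unitary_group N \<Longrightarrow>
      \<bar>Re (\<tau> (adj (W - Y) o\<^sub>L (W - Y))) - Re (\<tau> (adj (id_blinfun - Y) o\<^sub>L (id_blinfun - Y)))\<bar>
      \<le> Re (\<tau> (adj (W - id_blinfun) o\<^sub>L (W - id_blinfun)))"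
  shows "adj Y = Y"
proof -
  note Y' = unitary_groupD[OF Y]
  define P where "P = Y - adj Y"
  define Q where "Q = adj P o\<^sub>L P"
  have P: "P \<in> N" "P \<in> bounded_ops" "adj P = - P" using Y' by (simp_all add: P_def N_simps)
  have Q: "Q \<in> N" "hermitian Q" "real_spectrum Q \<subseteq> {0..4}"
    using N_closure(5)[OF N_adj[OF P(1)] P(1)] hermitian_adj_compose[OF P(2)]
      real_spectrum_unitary_diff[OF Y unitary_group_closure(3)[OF Y]]
    unfolding Q_def P_def by blast+
  have Q_apply: "blinfun_apply Q x = x + x - blinfun_apply Y (blinfun_apply Y x) - blinfun_apply (adj Y) (blinfun_apply (adj Y) x)" for x
    using Y' by (simp add: Q_def P_def blinfun.bilinear_simps)
  have c: "continuous_on {0..4::real} (\<lambda>t. sqrt (1 - t / 64))" by (intro continuous_intros) auto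
  define R where "R = cfc (\<lambda>t. sqrt (1 - t / 64)) Q"
  have R: "R \<in> N" "hermitian R" unfolding R_def
    by (rule N_cfc[OF Q(2,3) c Q(1)], rule hermitian_cfc[OF Q(2,3) c])
  then have R_adj: "R \<in> bounded_ops" "adj R = R" by (simp_all add: hermitian_iff_adj)
  have ci: "continuous_on {0..4::real} (\<lambda>t. 1 - t / 64)" "continuous_on {0..4::real} (\<lambda>t. t)"
    by (intro continuous_intros; simp)+
  have cfc_lin: "cfc (\<lambda>t. r - s * t) Q = r *\<^sub>R id_blinfun - s *\<^sub>R Q" for r s
    using cfc_diff[OF Q(2,3) continuous_on_const continuous_on_mult_left[OF ci(2)], of r s]
      cfc_const[OF Q(2,3)] cfc_cmult[OF Q(2,3) ci(2)] cfc_ident[OF Q(2,3)] by simp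
  have "R o\<^sub>L R = cfc (\<lambda>t. sqrt (1 - t / 64) * sqrt (1 - t / 64)) Q"
    unfolding R_def by (rule cfc_mult[OF Q(2,3) c c, symmetric])
  also have "\<dots> = cfc (\<lambda>t. 1 - (1 / 64) * t) Q"
    by (rule cfc_cong) (use Q(3) in auto)
  finally have RR: "R o\<^sub>L R = id_blinfun - (1 / 64) *\<^sub>R Q" by (simp only: cfc_lin scaleR_one)
  have RR: "blinfun_apply R (blinfun_apply R x) = x - (1 / 64) *\<^sub>R blinfun_apply Q x" for x
    using arg_cong[OF RR, of "\<lambda>A. blinfun_apply A x"] by (simp add: blinfun.bilinear_simps)
  have "R o\<^sub>L Y = Y o\<^sub>L R" "R o\<^sub>L adj Y = adj Y o\<^sub>L R"
    unfolding R_def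
    by (rule cfc_commute[OF Q(2,3) c], use Y' in simp, rule blinfun_eqI, use Y' in \<open>simp add: Q_apply blinfun.bilinear_simps\<close>)+
  then have RY: "blinfun_apply Y (blinfun_apply R x) = blinfun_apply R (blinfun_apply Y x)"
    "blinfun_apply (adj Y) (blinfun_apply R x) = blinfun_apply R (blinfun_apply (adj Y) x)" for x
    by (auto dest!: arg_cong[of _ _ "\<lambda>A. blinfun_apply A x"])
  define W where "W = R + (1 / 8) *\<^sub>R P"
  have W_adj: "adj W = R - (1 / 8) *\<^sub>R P" using R_adj P by (simp add: W_def)
  have W: "W \<in> unitary_group N"
  proof -
    have "adj W o\<^sub>L W = id_blinfun" "W o\<^sub>L adj W = id_blinfun"
      unfolding W_adj unfolding W_def P_def
      by (rule blinfun_eqI, use Y' in \<open>simp add: blinfun.bilinear_simps RR RY Q_apply algebra_simps\<close>)+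
    moreover have "W \<in> N" using R P by (simp add: W_def N_closure)
    ultimately show ?thesis by (simp add: unitary_group_def)
  qed
  let ?E = "id_blinfun - R"
  have E: "?E \<in> N" using R by (simp add: N_simps)
  have "nonneg_op (cfc (\<lambda>t. 1 - sqrt (1 - t / 64)) Q)"
    by (rule nonneg_op_cfc[OF Q(2,3)]) (auto intro!: continuous_intros)
  then have E_nonneg: "nonneg_op ?E"
    using cfc_diff[OF Q(2,3) continuous_on_const c, of 1] cfc_const[OF Q(2,3)] by (simp add: R_def)
  have "nonneg_op (cfc (\<lambda>t. sqrt (1 - t / 64) - (1 - (1 / 64) * t)) Q)"
  proof (rule nonneg_op_cfc[OF Q(2,3)])
    fix t :: real assume "t \<in> {0..4}"
    then have "(1 - t / 64)\<^sup>2 \<le> 1 - t / 64" by (simp add: power2_eq_square mult_left_le)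
    then show "0 \<le> sqrt (1 - t / 64) - (1 - (1 / 64) * t)" by (simp add: real_le_rsqrt)
  qed (intro continuous_intros; simp)
  moreover have "cfc (\<lambda>t. sqrt (1 - t / 64) - (1 - (1 / 64) * t)) Q = (1 / 64) *\<^sub>R Q - ?E"
    using cfc_diff[OF Q(2,3) c, of "\<lambda>t. 1 - (1 / 64) * t"] ci(1) cfc_lin[of 1 "1 / 64"]
    by (simp add: R_def)
  ultimately have E_le: "Re (\<tau> ?E) \<le> 1 / 64 * Re (\<tau> Q)"
    using trace_nonneg[of "(1 / 64) *\<^sub>R Q - ?E"] E Q by (simp add: trace_diff trace_scaleR N_closure)
  define F where "F = ?E o\<^sub>L (Y + adj Y)"
  have F: "F \<in> N" using E Y' by (simp add: F_def N_closure)
  have "?E o\<^sub>L (adj (Y - id_blinfun) o\<^sub>L (Y - id_blinfun)) = 2 *\<^sub>R ?E - F"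
    by (rule blinfun_eqI) (use Y' in \<open>simp add: F_def blinfun.bilinear_simps scaleR_2 algebra_simps\<close>)
  then have F_le: "Re (\<tau> F) \<le> 2 * Re (\<tau> ?E)"
    using trace_compose_nonneg[OF E E_nonneg, of "Y - id_blinfun"] E F Y' by (simp add: trace_diff trace_scaleR N_closure)
  note W' = unitary_groupD[OF W]
  have "(adj (W - Y) o\<^sub>L (W - Y)) - (adj (id_blinfun - Y) o\<^sub>L (id_blinfun - Y)) =
      Y + adj Y - (adj W o\<^sub>L Y) - (adj Y o\<^sub>L W)"
    by (rule blinfun_eqI) (use W' Y' in \<open>simp add: blinfun.bilinear_simps\<close>)
  also have "\<dots> = F - (1 / 8) *\<^sub>R Q"
    unfolding W_adj unfolding W_def P_def F_def
    by (rule blinfun_eqI) (use Y' in \<open>simp add: blinfun.bilinear_simps RY Q_apply algebra_simps\<close>)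
  finally have "(adj (W - Y) o\<^sub>L (W - Y)) - (adj (id_blinfun - Y) o\<^sub>L (id_blinfun - Y)) = F - (1 / 8) *\<^sub>R Q" .
  moreover have "adj (W - id_blinfun) o\<^sub>L (W - id_blinfun) = 2 *\<^sub>R ?E"
  proof -
    have "adj (W - id_blinfun) o\<^sub>L (W - id_blinfun) = 2 *\<^sub>R id_blinfun - W - adj W"
      by (rule blinfun_eqI) (use W' in \<open>simp add: blinfun.bilinear_simps scaleR_2\<close>)
    also have "\<dots> = 2 *\<^sub>R ?E" unfolding W_adj by (simp add: W_def scaleR_2)
    finally show ?thesis .
  qed
  ultimately have "\<bar>Re (\<tau> (F - (1 / 8) *\<^sub>R Q))\<bar> \<le> Re (\<tau> (2 *\<^sub>R ?E))"
    using bound[OF W] trace_diff[of "adj (W - Y) o\<^sub>L (W - Y)" "adj (id_blinfun - Y) o\<^sub>L (id_blinfun - Y)"]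
      unitary_groupD[OF W] Y' by (simp add: N_simps del: adj_simps)
  then have "1 / 8 * Re (\<tau> Q) \<le> 2 * Re (\<tau> ?E) + Re (\<tau> F)"
    using F Q E by (simp add: trace_diff[of F] trace_scaleR N_closure)
  with F_le E_le have "Re (\<tau> Q) \<le> 0" by linarith
  moreover have Qn: "nonneg_op Q" unfolding Q_def by (rule nonneg_op_adj_compose[OF P(2)])
  ultimately have "Re (\<tau> Q) = 0" using trace_nonneg[OF Q(1) Qn] by simp
  then have "Q = 0" by (rule trace_eq_0[OF Q(1) Qn])
  then have "P = 0" unfolding Q_def by (rule adj_compose_eq_0[OF P(2)])
  then show ?thesis by (simp add: P_def)
qed

end

section \<open>Isometries of unitary groups\<close>

theorem lemma2p3:
  fixes p :: real
    and N1 :: "('h::complex_hilbert_space \<Rightarrow>\<^sub>L 'h) set"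
    and N2 :: "('k::complex_hilbert_space \<Rightarrow>\<^sub>L 'k) set"
    and \<tau>1 :: "('h \<Rightarrow>\<^sub>L 'h) \<Rightarrow> complex"
    and \<tau>2 :: "('k \<Rightarrow>\<^sub>L 'k) \<Rightarrow> complex"
    and \<psi> :: "('h \<Rightarrow>\<^sub>L 'h) \<Rightarrow> ('k \<Rightarrow>\<^sub>L 'k)"
  assumes "0 < p"
    and "finite_factor N1 \<tau>1"
    and "finite_factor N2 \<tau>2"
    and "\<psi> ` unitary_group N1 = unitary_group N2"
    and "lp_isometry p N1 \<tau>1 \<tau>2 \<psi>"
    and "\<psi> id_blinfun = id_blinfun"
  shows "\<forall>U\<in>unitary_group N1. adj U = U \<longleftrightarrow> adj (\<psi> U) = \<psi> U"
proof
  note ff1 = assms(2) and ff2 = assms(3)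
  have p2: "0 < p / 2" using assms(1) by simp
  have \<psi>: "\<psi> V \<in> unitary_group N2" if "V \<in> unitary_group N1" for V
    using that assms(4) by blast
  have dist: "Re (\<tau>1 (cfc (\<lambda>t. t powr (p / 2)) (adj (V - W) o\<^sub>L (V - W)))) =
      Re (\<tau>2 (cfc (\<lambda>t. t powr (p / 2)) (adj (\<psi> V - \<psi> W) o\<^sub>L (\<psi> V - \<psi> W))))"
    if V: "V \<in> unitary_group N1" and W: "W \<in> unitary_group N1" for V W
  proof -
    have "V - W \<in> N1" "\<psi> V - \<psi> W \<in> N2"
      using unitary_groupD(1)[OF ff1 V] unitary_groupD(1)[OF ff1 W]
        unitary_groupD(1)[OF ff2 \<psi>[OF V]] unitary_groupD(1)[OF ff2 \<psi>[OF W]]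
      by (auto intro: N_closure(4)[OF ff1] N_closure(4)[OF ff2])
    then show ?thesis
      using assms(5) V W lp_norm_powr[OF ff1 assms(1) _ real_spectrum_unitary_diff[OF ff1 V W]]
        lp_norm_powr[OF ff2 assms(1) _ real_spectrum_unitary_diff[OF ff2 \<psi>[OF V] \<psi>[OF W]]]
      by (simp add: lp_isometry_def)
  qed
  fix U assume U: "U \<in> unitary_group N1"
  note id1 = unitary_group_closure(1)[OF ff1]
  show "adj U = U \<longleftrightarrow> adj (\<psi> U) = \<psi> U"
  proof (cases "p = 2")
    case False
    then have p1: "p / 2 \<noteq> 1" by simp
    note m1 = unitary_group_closure(2)[OF ff1 id1]
    have "\<psi> (- id_blinfun) = - id_blinfun"
      using trace_powr_eq_4_iff[OF ff1 m1 p2] trace_powr_eq_4_iff[OF ff2 \<psi>[OF m1] p2]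
        dist[OF m1 id1] assms(6) by simp
    then show ?thesis
      using selfadjoint_iff_trace_powr[OF ff1 U p2 p1] selfadjoint_iff_trace_powr[OF ff2 \<psi>[OF U] p2 p1]
        dist[OF U id1] dist[OF U m1] assms(6) by simp
  next
    case True
    have dist2: "Re (\<tau>1 (adj (V - W) o\<^sub>L (V - W))) = Re (\<tau>2 (adj (\<psi> V - \<psi> W) o\<^sub>L (\<psi> V - \<psi> W)))"
      if V: "V \<in> unitary_group N1" and W: "W \<in> unitary_group N1" for V W
      using dist[OF V W] unitary_groupD(2)[OF ff1 V] unitary_groupD(2)[OF ff1 W]
        unitary_groupD(2)[OF ff2 \<psi>[OF V]] unitary_groupD(2)[OF ff2 \<psi>[OF W]]
        cfc_powr_1[OF _ real_spectrum_unitary_diff[OF ff1 V W]]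
        cfc_powr_1[OF _ real_spectrum_unitary_diff[OF ff2 \<psi>[OF V] \<psi>[OF W]]] True
      by (simp del: adj_simps)
    have iff1: "adj U = U \<longleftrightarrow> (\<forall>W\<in>unitary_group N1.
        \<bar>Re (\<tau>1 (adj (W - U) o\<^sub>L (W - U))) - Re (\<tau>1 (adj (id_blinfun - U) o\<^sub>L (id_blinfun - U)))\<bar>
        \<le> Re (\<tau>1 (adj (W - id_blinfun) o\<^sub>L (W - id_blinfun))))"
      using selfadjoint_imp_L2_bound[OF ff1 U] L2_bound_imp_selfadjoint[OF ff1 U] by blast
    also have "\<dots> \<longleftrightarrow> (\<forall>W\<in>unitary_group N1.
        \<bar>Re (\<tau>2 (adj (\<psi> W - \<psi> U) o\<^sub>L (\<psi> W - \<psi> U))) - Re (\<tau>2 (adj (id_blinfun - \<psi> U) o\<^sub>L (id_blinfun - \<psi> U)))\<bar>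
        \<le> Re (\<tau>2 (adj (\<psi> W - id_blinfun) o\<^sub>L (\<psi> W - id_blinfun))))"
      using dist2[OF _ U] dist2[OF _ id1] id1 assms(6) by (intro ball_cong refl) (simp del: adj_simps)
    also have "\<dots> \<longleftrightarrow> adj (\<psi> U) = \<psi> U"
      using selfadjoint_imp_L2_bound[OF ff2 \<psi>[OF U] _ \<psi>] L2_bound_imp_selfadjoint[OF ff2 \<psi>[OF U]]
        assms(4) by (smt (verit) imageE)
    finally show ?thesis .
  qed
qed

end
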